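(* There exists a universal constant $\kappa_2>0$ such that the following holds. Let $m,n\ge 1$, let $C$ be a symmetric positive definite real $n\times n$ matrix and let $A$ be an arbitrary real $m\times n$ matrix. Let $\beta_1\ge\dots\ge\beta_n$ be the eigenvalues of $A^\top A$ and $\gamma_1\ge\dots\ge\gamma_n$ the eigenvalues of $C$. Let $U$ be drawn from the Haar probability measure on the orthogonal group $O(n)$. Then for every $\varepsilon\ge 0$, \[ \left|\tau_m(AUCU^\top A^\top)-\tau_n(C)\,\tau_m(AA^\top)\right|\le \frac{\varepsilon}{m}\sqrt{\sum_{i=1}^n\beta_i^2\gamma_i^2} \] with probability at least $1-2\exp(-\kappa_2 n\varepsilon^2)$. Equivalently, for every $\delta\in(0,1)$, with probability at least $1-\delta$, \[ \left|\tau_m(AUCU^\top A^\top)-\tau_n(C)\,\tau_m(AA^\top)\right|\le \left[\sqrt{\frac{2\log(2/\delta)}{\kappa_2 n}}\right]\frac{1}{m}\sqrt{\sum_{i=1}^n\beta_i^2\gamma_i^2}. \]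
   Context: For a real $k\times k$ matrix $M$, $\tau_k(M)=\frac1k\mathrm{Tr}(M)$ denotes the normalized trace. "Universal constant" means independent of $m,n,A,C,\varepsilon,\delta$. *)

theory Defs
  imports
    "HOL-Probability.Probability"
    "Jordan_Normal_Form.Char_Poly"
begin

text \<open>Matrices are those of \<open>Jordan_Normal_Form\<close>, whose dimensions are natural numbers, since the
  universal constant has to be chosen before the dimensions.\<close>

definition ntrace :: "nat \<Rightarrow> real mat \<Rightarrow> real" where
  "ntrace k M = (1 / real k) * (\<Sum>i<k. M $$ (i, i))"

definition sym_pos_def :: "nat \<Rightarrow> real mat \<Rightarrow> bool" where
  "sym_pos_def n C \<longleftrightarrow> C \<in> carrier_mat n n \<and> transpose_mat C = C \<and>
     (\<forall>v \<in> carrier_vec n. v \<noteq> 0\<^sub>v n \<longrightarrow> scalar_prod v (C *\<^sub>v v) > 0)"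

text \<open>The values \<open>\<beta> 1 \<ge> \<dots> \<ge> \<beta> n\<close> are the eigenvalues of \<open>M\<close> repeated according to algebraic
  multiplicity; \<open>proots\<close> is the multiset of roots of a polynomial. Values of \<open>\<beta>\<close> outside
  \<open>{1..n}\<close> are irrelevant.\<close>

definition eigenvalues_desc :: "nat \<Rightarrow> real mat \<Rightarrow> (nat \<Rightarrow> real) \<Rightarrow> bool" where
  "eigenvalues_desc n M \<beta> \<longleftrightarrow>
     antimono_on {1..n} \<beta> \<and> image_mset \<beta> (mset_set {1..n}) = proots (char_poly M)"

text \<open>The predicate \<open>orthogonal_mat\<close> of \<open>Jordan_Normal_Form\<close> is not used: it only asks for the
  columns to be nonzero and pairwise orthogonal, not normalized.\<close>

definition orthogonal_group :: "nat \<Rightarrow> real mat set" where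
  "orthogonal_group n = {U \<in> carrier_mat n n. transpose_mat U * U = 1\<^sub>m n \<and> U * transpose_mat U = 1\<^sub>m n}"

text \<open>The usual topology on \<open>O(n)\<close>, as a subspace of the space of \<open>n \<times> n\<close> matrices, i.e. of
  the product of \<open>n \<times> n\<close> copies of the real line.\<close>

definition orthogonal_topology :: "nat \<Rightarrow> real mat topology" where
  "orthogonal_topology n =
     pullback_topology (orthogonal_group n)
       (\<lambda>U. restrict (\<lambda>ij. U $$ ij) ({..<n} \<times> {..<n}))
       (product_topology (\<lambda>_. euclideanreal) ({..<n} \<times> {..<n}))"

text \<open>Haar probability measure on \<open>O(n)\<close>: a left-invariant Borel probability measure. (It is
  unique, and right-invariant and regular, because \<open>O(n)\<close> is a compact metrizable group.)\<close>

definition haar_prob_orthogonal :: "nat \<Rightarrow> real mat measure \<Rightarrow> bool" where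
  "haar_prob_orthogonal n \<mu> \<longleftrightarrow>
     prob_space \<mu> \<and>
     space \<mu> = orthogonal_group n \<and>
     sets \<mu> = sigma_sets (orthogonal_group n) {W. openin (orthogonal_topology n) W} \<and>
     (\<forall>V \<in> orthogonal_group n. \<forall>B \<in> sets \<mu>. emeasure \<mu> ((\<lambda>U. V * U) ` B) = emeasure \<mu> B)"

end

theory Submission
  imports Defs
begin

text \<open>Diagonalizing \<open>A\<^sup>T A = W diag(b) W\<^sup>T\<close> and \<open>C = Z diag(g) Z\<^sup>T\<close>, the unnormalized trace is
  \<open>\<Sum>\<^sub>i b\<^sub>i M\<^sub>i\<^sub>i\<close> with \<open>M = X diag(g) X\<^sup>T\<close> and \<open>X = W\<^sup>T U Z\<close>. Multiply \<open>X\<close> from the left by the rotation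
  by a fixed small angle in a uniformly random coordinate plane \<open>(p, q)\<close>. The Haar measure makes
  the old and the new point an exchangeable pair, and the centred trace is an exact eigenfunction
  of this random walk, with spectral gap proportional to the squared sine \<open>s\<^sup>2\<close> of the angle. As in
  Chatterjee's method of exchangeable pairs, the moment generating function \<open>\<phi>\<close> of the centred trace
  satisfies \<open>\<phi>'(t) \<le> t v \<phi>(t)\<close>, where \<open>v\<close> is the expected squared increment divided by the gap. To leading
  order in \<open>s\<close>, the increment is proportional to \<open>s (b\<^sub>p - b\<^sub>q) M\<^sub>p\<^sub>q\<close>, so \<open>v\<close> is a constant over \<open>n\<close> times
  the squared Frobenius norm of \<open>diag(b) M\<close>, which is at most \<open>\<Sum>\<^sub>i b\<^sub>i\<^sup>2 g\<^sub>i\<^sup>2\<close> by von Neumann's trace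
  inequality.\<close>

subsection \<open>Exponential moments from an exchangeable pair\<close>

text \<open>For u \<ge> v the tangent of exp at t u gives exp(t u) - exp(t v) \<le> t (u - v) exp(t
  u). Keeping both exponentials on the right makes the bound symmetric in u and v, so no order
  between the two points of an exchangeable pair has to be known.\<close>

lemma exp_diff_mult_diff_le:
  fixes t u v :: real
  assumes "t \<ge> 0"
  shows "(u - v) * (exp (t * u) - exp (t * v)) \<le> t * ((u - v)\<^sup>2 * exp (t * u) + (u - v)\<^sup>2 * exp (t * v))"
proof -
  have *: "(a - b) * (exp (t * a) - exp (t * b)) \<le> t * (a - b)\<^sup>2 * exp (t * a)" if "a \<ge> b" for a b :: real
  proof -
    have "exp (t * a) * (1 + (t * b - t * a)) \<le> exp (t * a) * exp (t * b - t * a)"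
      by (intro mult_left_mono exp_ge_add_one_self) simp
    hence "exp (t * a) - exp (t * b) \<le> t * (a - b) * exp (t * a)"
      by (simp add: exp_diff algebra_simps)
    hence "(a - b) * (exp (t * a) - exp (t * b)) \<le> (a - b) * (t * (a - b) * exp (t * a))"
      using that by (intro mult_left_mono) auto
    thus ?thesis by (simp add: power2_eq_square mult_ac)
  qed
  have nn: "0 \<le> t * (u - v)\<^sup>2 * exp (t * u)" "0 \<le> t * (u - v)\<^sup>2 * exp (t * v)"
    using assms by auto
  show ?thesis
  proof (cases "u \<ge> v")
    case True
    from *[OF this] nn show ?thesis by (simp add: algebra_simps)
  next
    case False
    hence "(v - u) * (exp (t * v) - exp (t * u)) \<le> t * (v - u)\<^sup>2 * exp (t * v)"
      by (intro *) simp
    with nn show ?thesis by (simp add: power2_commute[of v u] algebra_simps)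
  qed
qed

lemma (in prob_space) integrable_mult_exp_bounded:
  fixes f g :: "'a \<Rightarrow> real"
  assumes [measurable]: "f \<in> borel_measurable M" "g \<in> borel_measurable M"
    and f: "\<And>x. x \<in> space M \<Longrightarrow> \<bar>f x\<bar> \<le> L"
    and g: "\<And>x. x \<in> space M \<Longrightarrow> \<bar>g x\<bar> \<le> K"
    and t: "t \<ge> 0"
  shows "integrable M (\<lambda>x. f x * exp (t * g x))"
proof (intro integrable_const_bound[where B = "L * exp (t * K)"] AE_I2)
  fix x assume x: "x \<in> space M"
  have "t * g x \<le> t * K"
    using g[OF x] t by (intro mult_left_mono) auto
  thus "norm (f x * exp (t * g x)) \<le> L * exp (t * K)"
    using f[OF x] by (auto simp: abs_mult intro!: mult_mono order.trans[OF abs_ge_zero f[OF x]])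
qed measurable

text \<open>Invariance of the measure under \<open>T i\<close> replaces x by \<open>T i x\<close>,
  and \<open>T (\<iota> i)\<close> undoes \<open>T i\<close>; reindexing by the bijection
  \<open>\<iota>\<close> then swaps the roles. In other words, x and \<open>T i x\<close> with i
  uniform in \<open>I\<close> form an exchangeable pair, seen through \<open>g\<close>.\<close>

lemma (in prob_space) sum_expectation_exchange:
  fixes g :: "'a \<Rightarrow> real" and T :: "'i \<Rightarrow> 'a \<Rightarrow> 'a" and F :: "real \<Rightarrow> real \<Rightarrow> real"
  assumes T[measurable]: "\<And>i. i \<in> I \<Longrightarrow> T i \<in> measurable M M"
    and inv: "\<And>i. i \<in> I \<Longrightarrow> distr M M (T i) = M"
    and \<iota>: "bij_betw \<iota> I I"
    and T\<iota>: "\<And>i x. i \<in> I \<Longrightarrow> x \<in> space M \<Longrightarrow> T (\<iota> i) (T i x) = x"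
    and g[measurable]: "g \<in> borel_measurable M"
    and F[measurable]: "case_prod F \<in> borel_measurable (borel \<Otimes>\<^sub>M borel)"
  shows "(\<Sum>i\<in>I. expectation (\<lambda>x. F (g x) (g (T i x)))) = (\<Sum>i\<in>I. expectation (\<lambda>x. F (g (T i x)) (g x)))"
proof -
  have "expectation (\<lambda>x. F (g x) (g (T i x))) = expectation (\<lambda>x. F (g (T (\<iota> i) x)) (g x))" if i: "i \<in> I" for i
  proof -
    have [measurable]: "T i \<in> measurable M M" "T (\<iota> i) \<in> measurable M M"
      using T i bij_betwE[OF \<iota>] by auto
    have "expectation (\<lambda>x. F (g (T (\<iota> i) x)) (g x)) = integral\<^sup>L (distr M M (T i)) (\<lambda>x. F (g (T (\<iota> i) x)) (g x))"
      using inv[OF i] by simp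
    also have "\<dots> = expectation (\<lambda>x. F (g (T (\<iota> i) (T i x))) (g (T i x)))"
      by (rule integral_distr) measurable
    also have "\<dots> = expectation (\<lambda>x. F (g x) (g (T i x)))"
      by (rule Bochner_Integration.integral_cong) (auto simp: T\<iota> i)
    finally show ?thesis ..
  qed
  thus ?thesis
    using sum.reindex_bij_betw[OF \<iota>, of "\<lambda>i. expectation (\<lambda>x. F (g (T i x)) (g x))"] by simp
qed

text \<open>By \<open>eig\<close>, \<Lambda> E[g exp(t g)] is the summed expectation of increment
  times exp(t g). Antisymmetrizing under the exchange replaces exp(t g) by half the difference of
  the exponentials at the two points, which is of the order of the increment, so that only squared
  increments remain. \<open>\<Lambda>\<close> and \<open>D\<close> are sums over \<open>I\<close>,
  not means; only their ratio matters later.\<close>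

lemma (in prob_space) exchangeable_pair_mgf_bound:
  fixes g :: "'a \<Rightarrow> real" and T :: "'i \<Rightarrow> 'a \<Rightarrow> 'a"
  assumes "finite I"
    and T[measurable]: "\<And>i. i \<in> I \<Longrightarrow> T i \<in> measurable M M"
    and inv: "\<And>i. i \<in> I \<Longrightarrow> distr M M (T i) = M"
    and \<iota>: "bij_betw \<iota> I I"
    and T\<iota>: "\<And>i x. i \<in> I \<Longrightarrow> x \<in> space M \<Longrightarrow> T (\<iota> i) (T i x) = x"
    and g[measurable]: "g \<in> borel_measurable M"
    and bound: "\<And>x. x \<in> space M \<Longrightarrow> \<bar>g x\<bar> \<le> K"
    and eig: "\<And>x. x \<in> space M \<Longrightarrow> (\<Sum>i\<in>I. g x - g (T i x)) = \<Lambda> * g x"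
    and sq: "\<And>x. x \<in> space M \<Longrightarrow> (\<Sum>i\<in>I. (g x - g (T i x))\<^sup>2) \<le> D"
    and t: "t \<ge> 0"
  shows "\<Lambda> * expectation (\<lambda>x. g x * exp (t * g x)) \<le> t * D * expectation (\<lambda>x. exp (t * g x))"
proof -
  define d where "d = (\<lambda>i x. g x - g (T i x))"
  have dm[measurable]: "d i \<in> borel_measurable M" if "i \<in> I" for i
    using T[OF that] unfolding d_def by measurable
  have gT[measurable]: "(\<lambda>x. g (T i x)) \<in> borel_measurable M" if "i \<in> I" for i
    using T[OF that] by measurable
  have Tsp: "T i x \<in> space M" if "i \<in> I" "x \<in> space M" for i x
    using T[OF that(1)] that(2) by (rule measurable_space)
  have gint: "integrable M (\<lambda>x. exp (t * g x))"
    using integrable_mult_exp_bounded[where f = "\<lambda>_. 1" and L = 1, OF _ g _ bound t] by simp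
  have int: "integrable M (\<lambda>x. (d i x) ^ k * exp (t * g x))" "integrable M (\<lambda>x. (d i x) ^ k * exp (t * g (T i x)))"
    if i: "i \<in> I" for i k
  proof -
    have [measurable]: "d i \<in> borel_measurable M" "(\<lambda>x. g (T i x)) \<in> borel_measurable M"
      using i dm gT by auto
    have d2: "\<bar>d i x ^ k\<bar> \<le> (2 * K) ^ k" if "x \<in> space M" for x
      unfolding power_abs using bound[OF that] bound[OF Tsp[OF i that]]
      by (intro power_mono) (auto simp: d_def)
    show "integrable M (\<lambda>x. (d i x) ^ k * exp (t * g x))"
      by (intro integrable_mult_exp_bounded[OF _ _ d2 bound t]) measurable
    show "integrable M (\<lambda>x. (d i x) ^ k * exp (t * g (T i x)))"
      by (intro integrable_mult_exp_bounded[OF _ _ d2 bound[OF Tsp[OF i]] t]) measurable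
  qed
  note int1 = int[of _ 1, simplified] and int2 = int[of _ 2]
  note exch = sum_expectation_exchange[where T = T and \<iota> = \<iota> and I = I and g = g, OF T inv \<iota> T\<iota> g]
  \<comment> \<open>The exchange reverses the sign of the increment and moves the exponential to the
    other point. For squared increments, in \<open>ex2\<close>, the sign disappears.\<close>
  have ex1: "(\<Sum>i\<in>I. expectation (\<lambda>x. d i x * exp (t * g (T i x)))) = - (\<Sum>i\<in>I. expectation (\<lambda>x. d i x * exp (t * g x)))"
  proof -
    have "(\<Sum>i\<in>I. expectation (\<lambda>x. d i x * exp (t * g (T i x)))) =
        (\<Sum>i\<in>I. expectation (\<lambda>x. (g (T i x) - g x) * exp (t * g x)))"
      unfolding d_def by (rule exch[where F = "\<lambda>u v. (u - v) * exp (t * v)"]) measurable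
    also have "\<dots> = (\<Sum>i\<in>I. - expectation (\<lambda>x. d i x * exp (t * g x)))"
      unfolding integral_minus[symmetric] d_def by (simp add: algebra_simps)
    finally show ?thesis by (simp add: sum_negf)
  qed
  have ex2: "(\<Sum>i\<in>I. expectation (\<lambda>x. (d i x)\<^sup>2 * exp (t * g (T i x)))) = (\<Sum>i\<in>I. expectation (\<lambda>x. (d i x)\<^sup>2 * exp (t * g x)))"
  proof -
    have "(\<Sum>i\<in>I. expectation (\<lambda>x. (d i x)\<^sup>2 * exp (t * g (T i x)))) =
        (\<Sum>i\<in>I. expectation (\<lambda>x. (g (T i x) - g x)\<^sup>2 * exp (t * g x)))"
      unfolding d_def by (rule exch[where F = "\<lambda>u v. (u - v)\<^sup>2 * exp (t * v)"]) measurable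
    thus ?thesis by (simp add: d_def power2_commute)
  qed
  have sumd: "(\<Sum>i\<in>I. expectation (\<lambda>x. d i x * exp (t * g x))) = \<Lambda> * expectation (\<lambda>x. g x * exp (t * g x))"
  proof -
    have "(\<Sum>i\<in>I. expectation (\<lambda>x. d i x * exp (t * g x))) = expectation (\<lambda>x. \<Sum>i\<in>I. d i x * exp (t * g x))"
      by (rule Bochner_Integration.integral_sum[symmetric]) (rule int1)
    also have "\<dots> = expectation (\<lambda>x. \<Lambda> * (g x * exp (t * g x)))"
      by (rule Bochner_Integration.integral_cong)
         (simp_all only: sum_distrib_right[symmetric] d_def eig mult.assoc)
    finally show ?thesis by simp
  qed
  have sumd2: "(\<Sum>i\<in>I. expectation (\<lambda>x. (d i x)\<^sup>2 * exp (t * g x))) \<le> D * expectation (\<lambda>x. exp (t * g x))"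
  proof -
    have "(\<Sum>i\<in>I. expectation (\<lambda>x. (d i x)\<^sup>2 * exp (t * g x))) = expectation (\<lambda>x. \<Sum>i\<in>I. (d i x)\<^sup>2 * exp (t * g x))"
      by (rule Bochner_Integration.integral_sum[symmetric]) (rule int2)
    also have "\<dots> \<le> expectation (\<lambda>x. D * exp (t * g x))"
    proof (rule integral_mono)
      show "integrable M (\<lambda>x. \<Sum>i\<in>I. (d i x)\<^sup>2 * exp (t * g x))"
        by (rule Bochner_Integration.integrable_sum) (rule int2)
      show "integrable M (\<lambda>x. D * exp (t * g x))"
        using gint by simp
    qed (use sq in \<open>simp add: sum_distrib_right[symmetric] d_def\<close>)
    finally show ?thesis by simp
  qed
  have "2 * (\<Lambda> * expectation (\<lambda>x. g x * exp (t * g x))) =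
      (\<Sum>i\<in>I. expectation (\<lambda>x. d i x * exp (t * g x)) - expectation (\<lambda>x. d i x * exp (t * g (T i x))))"
    using sumd ex1 by (simp add: sum_subtractf)
  also have "\<dots> = (\<Sum>i\<in>I. expectation (\<lambda>x. d i x * (exp (t * g x) - exp (t * g (T i x)))))"
    using int1 by (intro sum.cong refl) (simp add: right_diff_distrib)
  also have "\<dots> \<le> (\<Sum>i\<in>I. expectation (\<lambda>x. t * ((d i x)\<^sup>2 * exp (t * g x) + (d i x)\<^sup>2 * exp (t * g (T i x)))))"
  proof (intro sum_mono integral_mono)
    fix i assume i: "i \<in> I"
    show "integrable M (\<lambda>x. d i x * (exp (t * g x) - exp (t * g (T i x))))"
      unfolding right_diff_distrib using int1[OF i] by (rule Bochner_Integration.integrable_diff)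
    show "integrable M (\<lambda>x. t * ((d i x)\<^sup>2 * exp (t * g x) + (d i x)\<^sup>2 * exp (t * g (T i x))))"
      using int2[OF i] by simp
    show "d i x * (exp (t * g x) - exp (t * g (T i x))) \<le>
        t * ((d i x)\<^sup>2 * exp (t * g x) + (d i x)\<^sup>2 * exp (t * g (T i x)))" for x
      unfolding d_def by (rule exp_diff_mult_diff_le[OF t])
  qed
  also have "\<dots> = t * ((\<Sum>i\<in>I. expectation (\<lambda>x. (d i x)\<^sup>2 * exp (t * g x))) + (\<Sum>i\<in>I. expectation (\<lambda>x. (d i x)\<^sup>2 * exp (t * g (T i x)))))"
    using int2 by (simp add: sum.distrib sum_distrib_left algebra_simps)
  also have "\<dots> \<le> t * (2 * (D * expectation (\<lambda>x. exp (t * g x))))"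
    unfolding ex2 using sumd2 t by (intro mult_left_mono) auto
  finally show ?thesis by simp
qed

section \<open>From the differential inequality to a Gaussian tail\<close>

lemma (in prob_space) mgf_bound_of_derivative_bound:
  fixes g :: "'a \<Rightarrow> real"
  assumes g[measurable]: "g \<in> borel_measurable M"
    and bound: "\<And>x. x \<in> space M \<Longrightarrow> \<bar>g x\<bar> \<le> K"
    and v: "v \<ge> 0"
    and deriv: "\<And>t. t \<ge> 0 \<Longrightarrow> expectation (\<lambda>x. g x * exp (t * g x)) \<le> t * v * expectation (\<lambda>x. exp (t * g x))"
    and t: "t \<ge> 0"
  shows "expectation (\<lambda>x. exp (t * g x)) \<le> exp (2 * v * t\<^sup>2)"
proof -
  define \<phi> where "\<phi> = (\<lambda>t. expectation (\<lambda>x. exp (t * g x)))"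
  have int: "integrable M (\<lambda>x. exp (t * g x))" "integrable M (\<lambda>x. g x * exp (t * g x))" if "t \<ge> 0" for t
    using integrable_mult_exp_bounded[where f = "\<lambda>_. 1" and L = 1, OF _ g _ bound that]
      integrable_mult_exp_bounded[OF g g bound bound that] by auto
  \<comment> \<open>An implicit Euler step: exp(-h g) \<ge> 1 - h g bounds the increment of \<phi>
    by h times its derivative at the right end point s + h, where \<open>deriv\<close> is
    applied.\<close>
  have step: "\<phi> (s + h) * (1 - h * (s + h) * v) \<le> \<phi> s" if "s \<ge> 0" "h \<ge> 0" for s h
  proof -
    have "\<phi> (s + h) - \<phi> s = expectation (\<lambda>x. exp ((s + h) * g x) - exp (s * g x))"
      unfolding \<phi>_def using int that by simp
    also have "\<dots> \<le> expectation (\<lambda>x. h * (g x * exp ((s + h) * g x)))"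
    proof (rule integral_mono)
      fix x
      have "exp ((s + h) * g x) * (1 + (- h * g x)) \<le> exp ((s + h) * g x) * exp (- h * g x)"
        by (intro mult_left_mono exp_ge_add_one_self) simp
      also have "\<dots> = exp (s * g x)"
        by (simp add: exp_add[symmetric] algebra_simps)
      finally show "exp ((s + h) * g x) - exp (s * g x) \<le> h * (g x * exp ((s + h) * g x))"
        by (simp add: algebra_simps)
    qed (use int that in auto)
    also have "\<dots> \<le> h * ((s + h) * v * \<phi> (s + h))"
      using deriv[of "s + h"] that by (auto simp: \<phi>_def intro!: mult_left_mono)
    finally show ?thesis by (simp add: algebra_simps)
  qed
  \<comment> \<open>A discrete Gronwall argument, which spares the differentiation of \<open>\<phi>\<close> and costs a factor \<open>4\<close> in
    the exponent.\<close>
  obtain N :: nat where N: "2 * t\<^sup>2 * v < real N" and N0: "N > 0"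
    using reals_Archimedean2[of "max 0 (2 * t\<^sup>2 * v)"] by auto
  define h where "h = t / real N"
  have h: "h \<ge> 0" "real N * h = t" using t N0 by (auto simp: h_def)
  have hN: "h\<^sup>2 * real N * v \<le> 1 / 2"
    using N N0 by (simp add: h_def power2_eq_square field_simps)
  \<comment> \<open>Step j costs at most a factor exp(2 x) with x = h^2 j v, and the sum of 2 j over
    j \<le> k is k (k + 1).\<close>
  have "\<phi> (real k * h) \<le> exp (v * h\<^sup>2 * (real k * (real k + 1)))" if "k \<le> N" for k
    using that
  proof (induction k)
    case 0
    show ?case by (simp add: \<phi>_def prob_space)
  next
    case (Suc k)
    define x where "x = h * (real k * h + h) * v"
    have x: "x = h\<^sup>2 * real (Suc k) * v" by (simp add: x_def power2_eq_square algebra_simps)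
    also have "\<dots> \<le> h\<^sup>2 * real N * v"
      using Suc.prems v by (intro mult_right_mono mult_left_mono) auto
    finally have x2: "x \<le> 1 / 2" using hN by simp
    have x0: "0 \<le> x" unfolding x using v by simp
    have "\<phi> (real (Suc k) * h) * (1 - x) \<le> \<phi> (real k * h)"
      using step[of "real k * h" h] h by (simp add: x_def algebra_simps)
    also have "\<dots> \<le> exp (v * h\<^sup>2 * (real k * (real k + 1)))"
      using Suc by simp
    finally have 1: "\<phi> (real (Suc k) * h) \<le> exp (v * h\<^sup>2 * (real k * (real k + 1))) / (1 - x)"
      using x2 by (simp add: field_simps)
    \<comment> \<open>This leads to 1 / (1 - x) \<le> exp(2 x) on [0, 1/2].\<close>
    have "- x - 2 * x\<^sup>2 \<le> ln (1 - x)"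
      using x0 x2 by (rule ln_one_minus_pos_lower_bound)
    moreover have "2 * x\<^sup>2 \<le> x" using x0 x2 mult_left_mono[of "2 * x" 1 x] by (simp add: power2_eq_square)
    ultimately have "- (2 * x) \<le> ln (1 - x)" by linarith
    hence "exp (- (2 * x)) \<le> 1 - x" using x2 by (subst (asm) ln_ge_iff) auto
    hence "1 / (1 - x) \<le> exp (2 * x)"
      using x2 by (simp add: exp_minus field_simps)
    hence "exp (v * h\<^sup>2 * (real k * (real k + 1))) * (1 / (1 - x)) \<le> exp (v * h\<^sup>2 * (real k * (real k + 1))) * exp (2 * x)"
      by (intro mult_left_mono) auto
    also have "\<dots> = exp (v * h\<^sup>2 * (real (Suc k) * (real (Suc k) + 1)))"
      unfolding exp_add[symmetric] x by (simp add: algebra_simps)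
    finally show ?case using 1 by simp
  qed
  from this[of N] have "\<phi> t \<le> exp (v * h\<^sup>2 * (real N * (real N + 1)))" using h by simp
  also have "v * h\<^sup>2 * (real N * (real N + 1)) \<le> v * h\<^sup>2 * (real N * (2 * real N))"
    using N0 v by (intro mult_left_mono) auto
  also have "\<dots> = 2 * v * (real N * h)\<^sup>2" by (simp add: power2_eq_square)
  finally show ?thesis using h by (simp add: \<phi>_def)
qed

lemma (in prob_space) tail_bound_of_derivative_bound:
  fixes g :: "'a \<Rightarrow> real"
  assumes g[measurable]: "g \<in> borel_measurable M"
    and bound: "\<And>x. x \<in> space M \<Longrightarrow> \<bar>g x\<bar> \<le> K"
    and v: "v > 0"
    and deriv: "\<And>t. t \<ge> 0 \<Longrightarrow> expectation (\<lambda>x. g x * exp (t * g x)) \<le> t * v * expectation (\<lambda>x. exp (t * g x))"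
    and a: "a \<ge> 0"
  shows "prob {x \<in> space M. g x \<ge> a} \<le> exp (- a\<^sup>2 / (8 * v))"
proof (cases "a = 0")
  case False
  \<comment> \<open>Chernoff's bound: this t minimizes the exponent 2 v t^2 - t a.\<close>
  define t where "t = a / (4 * v)"
  have t: "t > 0" using a v False by (simp add: t_def)
  have int: "integrable M (\<lambda>x. exp (t * g x))"
    using integrable_mult_exp_bounded[where f = "\<lambda>_. 1" and L = 1, OF _ g _ bound less_imp_le[OF t]] by simp
  have "prob {x \<in> space M. g x \<ge> a} = prob {x \<in> space M. exp (t * g x) \<ge> exp (t * a)}"
    using t by simp
  also have "\<dots> \<le> expectation (\<lambda>x. exp (t * g x)) / exp (t * a)"
    by (rule integral_Markov_inequality_measure[where A = "{}"]) (use int in auto)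
  also have "\<dots> \<le> exp (2 * v * t\<^sup>2) / exp (t * a)"
    using mgf_bound_of_derivative_bound[OF g bound less_imp_le[OF v] deriv less_imp_le[OF t]]
    by (intro divide_right_mono) auto
  also have "\<dots> = exp (2 * v * t\<^sup>2 - t * a)" by (simp add: exp_diff)
  also have "2 * v * t\<^sup>2 - t * a = - a\<^sup>2 / (8 * v)"
    using v by (simp add: t_def power2_eq_square field_simps)
  finally show ?thesis .
qed simp

subsection \<open>The orthogonal group and its Haar measure\<close>

lemma continuous_map_orthogonal_entry:
  assumes "i < n" "j < n"
  shows "continuous_map (orthogonal_topology n) euclideanreal (\<lambda>U. U $$ (i, j))"
proof -
  have "continuous_map (product_topology (\<lambda>_. euclideanreal) ({..<n} \<times> {..<n})) euclideanreal (\<lambda>f. f (i, j))"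
    using assms by (intro continuous_map_product_projection) auto
  from continuous_map_pullback[OF this, of "orthogonal_group n" "\<lambda>U. restrict (\<lambda>ij. U $$ ij) ({..<n} \<times> {..<n})"]
  show ?thesis using assms by (simp add: orthogonal_topology_def comp_def)
qed

lemma topspace_orthogonal_topology: "topspace (orthogonal_topology n) = orthogonal_group n"
  by (auto simp: orthogonal_topology_def topspace_pullback_topology)

lemma orthogonal_group_mult:
  assumes "V \<in> orthogonal_group n" "U \<in> orthogonal_group n"
  shows "V * U \<in> orthogonal_group n"
proof -
  have c: "V \<in> carrier_mat n n" "U \<in> carrier_mat n n"
    "transpose_mat V \<in> carrier_mat n n" "transpose_mat U \<in> carrier_mat n n"
    using assms by (auto simp: orthogonal_group_def)
  have "transpose_mat (V * U) * (V * U) = transpose_mat U * (transpose_mat V * V) * U"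
    using c by (simp add: transpose_mult[of V n n U n] assoc_mult_mat[of _ n n _ n _ n])
  moreover have "(V * U) * transpose_mat (V * U) = V * (U * transpose_mat U) * transpose_mat V"
    using c by (simp add: transpose_mult[of V n n U n] assoc_mult_mat[of _ n n _ n _ n])
  ultimately show ?thesis
    using assms c by (simp add: orthogonal_group_def)
qed

lemma orthogonal_group_transpose:
  "V \<in> orthogonal_group n \<Longrightarrow> transpose_mat V \<in> orthogonal_group n"
  by (simp add: orthogonal_group_def)

lemma orthogonal_group_transpose_cancel:
  assumes "V \<in> orthogonal_group n" "U \<in> carrier_mat n k"
  shows "V * (transpose_mat V * U) = U" "transpose_mat V * (V * U) = U"
  using assms assoc_mult_mat[of V n n "transpose_mat V" n U k] assoc_mult_mat[of "transpose_mat V" n n V n U k]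
  by (simp_all add: orthogonal_group_def)

lemma continuous_map_orthogonal_mult:
  assumes V: "V \<in> orthogonal_group n"
  shows "continuous_map (orthogonal_topology n) (orthogonal_topology n) (\<lambda>U. V * U)"
  unfolding orthogonal_topology_def[of n]
proof (rule continuous_map_pullback', unfold orthogonal_topology_def[of n, symmetric])
  show "topspace (orthogonal_topology n) \<subseteq> (*) V -` orthogonal_group n"
    using orthogonal_group_mult[OF V] by (auto simp: topspace_orthogonal_topology)
  have Vc: "V \<in> carrier_mat n n" using V by (simp add: orthogonal_group_def)
  have "continuous_map (orthogonal_topology n) euclideanreal (\<lambda>U. (V * U) $$ (i, j))" if "i < n" "j < n" for i j
  proof -
    have "continuous_map (orthogonal_topology n) euclideanreal (\<lambda>U. \<Sum>k<n. V $$ (i, k) * U $$ (k, j))"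
      using that by (intro continuous_intros continuous_map_orthogonal_entry) auto
    thus ?thesis
      by (rule continuous_map_eq)
         (use Vc that in \<open>auto simp: topspace_orthogonal_topology orthogonal_group_def scalar_prod_def atLeast0LessThan\<close>)
  qed
  thus "continuous_map (orthogonal_topology n) (product_topology (\<lambda>_. euclideanreal) ({..<n} \<times> {..<n}))
      ((\<lambda>U. restrict (\<lambda>ij. U $$ ij) ({..<n} \<times> {..<n})) \<circ> (*) V)"
    by (auto simp: continuous_map_componentwise comp_def)
qed

lemma haar_measurable_of_continuous_map:
  fixes f :: "real mat \<Rightarrow> real"
  assumes \<mu>: "haar_prob_orthogonal n \<mu>" and f: "continuous_map (orthogonal_topology n) euclideanreal f"
  shows "f \<in> borel_measurable \<mu>"
proof (rule borel_measurableI)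
  fix S :: "real set" assume "open S"
  hence "openin (orthogonal_topology n) {U \<in> topspace (orthogonal_topology n). f U \<in> S}"
    using f by (intro openin_continuous_map_preimage) auto
  moreover have "f -` S \<inter> space \<mu> = {U \<in> topspace (orthogonal_topology n). f U \<in> S}"
    using \<mu> by (auto simp: haar_prob_orthogonal_def topspace_orthogonal_topology)
  ultimately show "f -` S \<inter> space \<mu> \<in> sets \<mu>"
    using \<mu> by (auto simp: haar_prob_orthogonal_def)
qed

lemma haar_measurable_mult:
  assumes \<mu>: "haar_prob_orthogonal n \<mu>" and V: "V \<in> orthogonal_group n"
  shows "(\<lambda>U. V * U) \<in> measurable \<mu> \<mu>"
proof (rule measurable_sigma_sets)
  show "sets \<mu> = sigma_sets (orthogonal_group n) {W. openin (orthogonal_topology n) W}"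
    using \<mu> by (simp add: haar_prob_orthogonal_def)
  show "{W. openin (orthogonal_topology n) W} \<subseteq> Pow (orthogonal_group n)"
    using openin_subset[of "orthogonal_topology n"] by (auto simp: topspace_orthogonal_topology)
  show "(\<lambda>U. V * U) \<in> space \<mu> \<rightarrow> orthogonal_group n"
    using \<mu> orthogonal_group_mult[OF V] by (auto simp: haar_prob_orthogonal_def)
  fix W assume "W \<in> {W. openin (orthogonal_topology n) W}"
  hence "openin (orthogonal_topology n) {U \<in> topspace (orthogonal_topology n). V * U \<in> W}"
    using continuous_map_orthogonal_mult[OF V] by (intro openin_continuous_map_preimage) auto
  moreover have "(\<lambda>U. V * U) -` W \<inter> space \<mu> = {U \<in> topspace (orthogonal_topology n). V * U \<in> W}"
    using \<mu> by (auto simp: haar_prob_orthogonal_def topspace_orthogonal_topology)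
  ultimately show "(\<lambda>U. V * U) -` W \<inter> space \<mu> \<in> sets \<mu>"
    using \<mu> by (auto simp: haar_prob_orthogonal_def)
qed

text \<open>The definition of the Haar measure speaks of images of Borel sets, a push-forward of
  preimages. The preimage under multiplication by \<open>V\<close> is the image under multiplication
  by its transpose.\<close>

lemma haar_distr_mult:
  assumes \<mu>: "haar_prob_orthogonal n \<mu>" and V: "V \<in> orthogonal_group n"
  shows "distr \<mu> \<mu> (\<lambda>U. V * U) = \<mu>"
proof (rule measure_eqI)
  fix B assume "B \<in> sets (distr \<mu> \<mu> (\<lambda>U. V * U))"
  hence B: "B \<in> sets \<mu>" by simp
  have sp: "space \<mu> = orthogonal_group n" using \<mu> by (simp add: haar_prob_orthogonal_def)
  hence Bs: "B \<subseteq> orthogonal_group n" using sets.sets_into_space[OF B] by simp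
  have carr: "U \<in> carrier_mat n n" if "U \<in> orthogonal_group n" for U
    using that by (simp add: orthogonal_group_def)
  have "(\<lambda>U. V * U) -` B \<inter> space \<mu> = (\<lambda>U. transpose_mat V * U) ` B"
  proof (intro equalityI subsetI)
    fix U assume "U \<in> (\<lambda>U. V * U) -` B \<inter> space \<mu>"
    hence U: "U \<in> orthogonal_group n" "V * U \<in> B" using sp by auto
    have "transpose_mat V * (V * U) = U" by (rule orthogonal_group_transpose_cancel[OF V carr[OF U(1)]])
    thus "U \<in> (\<lambda>U. transpose_mat V * U) ` B" using U by (metis image_eqI)
  next
    fix U assume "U \<in> (\<lambda>U. transpose_mat V * U) ` B"
    then obtain W where W: "W \<in> B" "U = transpose_mat V * W" by auto
    hence "V * U = W" using Bs carr orthogonal_group_transpose_cancel[OF V] by auto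
    thus "U \<in> (\<lambda>U. V * U) -` B \<inter> space \<mu>"
      using W Bs sp orthogonal_group_mult[OF orthogonal_group_transpose[OF V]] by auto
  qed
  hence "emeasure (distr \<mu> \<mu> (\<lambda>U. V * U)) B = emeasure \<mu> ((\<lambda>U. transpose_mat V * U) ` B)"
    using B haar_measurable_mult[OF \<mu> V] by (simp add: emeasure_distr)
  also have "\<dots> = emeasure \<mu> B"
    using \<mu> orthogonal_group_transpose[OF V] B by (simp add: haar_prob_orthogonal_def)
  finally show "emeasure (distr \<mu> \<mu> (\<lambda>U. V * U)) B = emeasure \<mu> B" .
qed simp

subsection \<open>Random Givens rotations\<close>

text \<open>Abel summation, run as an induction: the weighted sum up to k dominates
  \<open>x k\<close> times the partial sum of \<open>d\<close>, and at the last index that partial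
  sum vanishes.\<close>

lemma sum_mult_nonneg_of_partial_sums_nonneg:
  fixes x d :: "nat \<Rightarrow> real"
  assumes x: "\<And>i j. i \<le> j \<Longrightarrow> j < n \<Longrightarrow> x j \<le> x i"
    and S: "\<And>k. k < n \<Longrightarrow> 0 \<le> (\<Sum>i<k. d i)"
    and S0: "(\<Sum>i<n. d i) = 0"
  shows "0 \<le> (\<Sum>i<n. x i * d i)"
proof (cases n)
  case (Suc m)
  have "x k * (\<Sum>i<Suc k. d i) \<le> (\<Sum>i<Suc k. x i * d i)" if "k < n" for k
    using that
  proof (induction k)
    case (Suc k)
    have "x (Suc k) * (\<Sum>i<Suc k. d i) \<le> x k * (\<Sum>i<Suc k. d i)"
      using Suc.prems x[of k "Suc k"] S[of "Suc k"] by (intro mult_right_mono) auto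
    also have "\<dots> \<le> (\<Sum>i<Suc k. x i * d i)" using Suc by simp
    finally show ?case by (simp add: distrib_left)
  qed simp
  from this[of m] Suc S0 show ?thesis by simp
qed simp

text \<open>The average P y is majorized by the decreasing vector y: the differences
  \<open>d\<close> have nonnegative partial sums and total 0, so Abel summation against the
  decreasing x applies.\<close>

lemma doubly_stochastic_bilinear_le:
  fixes P :: "nat \<Rightarrow> nat \<Rightarrow> real" and x y :: "nat \<Rightarrow> real"
  assumes P0: "\<And>i j. i < n \<Longrightarrow> j < n \<Longrightarrow> 0 \<le> P i j"
    and rows: "\<And>i. i < n \<Longrightarrow> (\<Sum>j<n. P i j) = 1"
    and cols: "\<And>j. j < n \<Longrightarrow> (\<Sum>i<n. P i j) = 1"
    and x: "\<And>i j. i \<le> j \<Longrightarrow> j < n \<Longrightarrow> x j \<le> x i"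
    and y: "\<And>i j. i \<le> j \<Longrightarrow> j < n \<Longrightarrow> y j \<le> y i"
  shows "(\<Sum>i<n. x i * (\<Sum>j<n. P i j * y j)) \<le> (\<Sum>i<n. x i * y i)"
proof -
  define d where "d = (\<lambda>i. y i - (\<Sum>j<n. P i j * y j))"
  have Sd: "(\<Sum>i<k. d i) = (\<Sum>i<k. y i) - (\<Sum>j<n. (\<Sum>i<k. P i j) * y j)" for k
    unfolding d_def sum_subtractf sum_distrib_right by (subst sum.swap) simp
  have S0: "(\<Sum>i<n. d i) = 0"
    unfolding Sd using cols by simp
  have S: "0 \<le> (\<Sum>i<k. d i)" if k: "k < n" for k
  proof -
    define w where "w = (\<lambda>j. \<Sum>i<k. P i j)"
    define e :: "nat \<Rightarrow> real" where "e = (\<lambda>i. of_bool (i < k))"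
    have w: "0 \<le> w j" "w j \<le> 1" if "j < n" for j
    proof -
      show "0 \<le> w j" unfolding w_def using P0 k that by (intro sum_nonneg) auto
      have "w j \<le> (\<Sum>i<n. P i j)" unfolding w_def using P0 k that by (intro sum_mono2) auto
      thus "w j \<le> 1" using cols[OF that] by simp
    qed
    have restr: "(\<Sum>i<k. f i) = (\<Sum>i<n. e i * f i)" for f :: "nat \<Rightarrow> real"
      unfolding e_def of_bool_def using k
      by (intro sum.mono_neutral_cong_left) auto
    have "(\<Sum>j<n. w j) = (\<Sum>i<k. \<Sum>j<n. P i j)" unfolding w_def by (rule sum.swap)
    also have "\<dots> = (\<Sum>i<k. 1)" using rows k by (intro sum.cong) auto
    finally have sw: "(\<Sum>j<n. w j) = (\<Sum>j<n. e j)" using restr[of "\<lambda>_. 1"] by simp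
    have "(\<Sum>i<k. d i) = (\<Sum>i<n. (e i - w i) * y i)"
      using Sd[of k] restr[of y] by (simp add: w_def sum_subtractf left_diff_distrib)
    \<comment> \<open>The weights \<open>e\<close> and \<open>w\<close> have equal totals, so y may
      be shifted by the constant \<open>y k\<close>. After the shift both factors change sign at k
      and every summand is nonnegative.\<close>
    also have "\<dots> = (\<Sum>i<n. (e i - w i) * (y i - y k)) + y k * (\<Sum>i<n. e i - w i)"
      by (simp add: sum_distrib_left sum.distrib[symmetric] algebra_simps)
    also have "(\<Sum>i<n. e i - w i) = 0" using sw by (simp add: sum_subtractf)
    finally have "(\<Sum>i<k. d i) = (\<Sum>i<n. (e i - w i) * (y i - y k))" by simp
    also have "\<dots> \<ge> 0"
    proof (intro sum_nonneg)
      fix i assume "i \<in> {..<n}"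
      hence i: "i < n" by simp
      show "0 \<le> (e i - w i) * (y i - y k)"
      proof (cases "i < k")
        case True
        thus ?thesis using w[OF i] y[of i k] k by (auto simp: e_def)
      next
        case False
        thus ?thesis using w[OF i] y[of k i] i by (auto simp: e_def intro!: mult_nonneg_nonpos)
      qed
    qed
    finally show ?thesis .
  qed
  have "0 \<le> (\<Sum>i<n. x i * d i)"
    by (rule sum_mult_nonneg_of_partial_sums_nonneg[OF x S S0])
  thus ?thesis by (simp add: d_def right_diff_distrib sum_subtractf)
qed

section \<open>Rotations of coordinate planes and orthogonality relations\<close>

text \<open>Swapping p and q reverses the sense of rotation. The case p = q is set to the identity,
  so that the random plane can be drawn from all n^2 ordered pairs: this set is closed under
  swapping and the double sums need no restriction.\<close>

definition givens :: "nat \<Rightarrow> nat \<Rightarrow> nat \<Rightarrow> real \<Rightarrow> real \<Rightarrow> real mat" where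
  "givens n p q c s = mat n n (\<lambda>(i, j).
     if p = q then of_bool (i = j)
     else if i = p then (if j = p then c else if j = q then s else 0)
     else if i = q then (if j = q then c else if j = p then - s else 0)
     else of_bool (i = j))"

lemma givens_carrier [simp]: "givens n p q c s \<in> carrier_mat n n"
  and givens_dim [simp]: "dim_row (givens n p q c s) = n" "dim_col (givens n p q c s) = n"
  by (simp_all add: givens_def)

lemma givens_mult_index:
  assumes X: "X \<in> carrier_mat n n" and pq: "p < n" "q < n" and ij: "i < n" "k < n"
  shows "(givens n p q c s * X) $$ (i, k) =
    (if p = q then X $$ (i, k)
     else if i = p then c * X $$ (p, k) + s * X $$ (q, k)
     else if i = q then c * X $$ (q, k) - s * X $$ (p, k)
     else X $$ (i, k))"
proof -
  have "(givens n p q c s * X) $$ (i, k) = (\<Sum>j<n. givens n p q c s $$ (i, j) * X $$ (j, k))"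
    using X ij by (simp add: scalar_prod_def atLeast0LessThan)
  also have "\<dots> = (\<Sum>j<n. 
     (if p = q then (if j = i then X $$ (j, k) else 0)
     else if i = p then ((if j = p then c * X $$ (j, k) else 0) + (if j = q then s * X $$ (j, k) else 0))
     else if i = q then ((if j = q then c * X $$ (j, k) else 0) - (if j = p then s * X $$ (j, k) else 0))
     else (if j = i then X $$ (j, k) else 0)))"
    using ij by (intro sum.cong refl) (auto simp: givens_def)
  also have "\<dots> = (if p = q then X $$ (i, k)
     else if i = p then c * X $$ (p, k) + s * X $$ (q, k)
     else if i = q then c * X $$ (q, k) - s * X $$ (p, k)
     else X $$ (i, k))"
    using pq ij by (simp add: sum.distrib sum_subtractf)
  finally show ?thesis .
qed

lemma givens_inverse:
  assumes "p < n" "q < n" "c\<^sup>2 + s\<^sup>2 = 1"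
  shows "givens n q p c s * givens n p q c s = 1\<^sub>m n"
proof (rule eq_matI)
  fix i j assume "i < dim_row (1\<^sub>m n :: real mat)" "j < dim_col (1\<^sub>m n :: real mat)"
  hence "i < n" "j < n" by auto
  thus "(givens n q p c s * givens n p q c s) $$ (i, j) = 1\<^sub>m n $$ (i, j)"
    using assms by (subst givens_mult_index) (auto simp: givens_def power2_eq_square)
qed auto

lemma givens_transpose: "transpose_mat (givens n p q c s) = givens n q p c s"
  by (rule eq_matI) (auto simp: givens_def)

lemma givens_orthogonal:
  assumes "p < n" "q < n" "c\<^sup>2 + s\<^sup>2 = 1"
  shows "givens n p q c s \<in> orthogonal_group n"
  using givens_inverse[OF assms] givens_inverse[OF assms(2,1,3)]
  by (simp add: orthogonal_group_def givens_transpose)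

lemma orthogonal_group_rows:
  assumes "X \<in> orthogonal_group n" "i < n" "j < n"
  shows "(\<Sum>k<n. X $$ (i, k) * X $$ (j, k)) = of_bool (i = j)"
proof -
  have X: "X \<in> carrier_mat n n" using assms by (simp add: orthogonal_group_def)
  have "(X * transpose_mat X) $$ (i, j) = (\<Sum>k<n. X $$ (i, k) * X $$ (j, k))"
    using X assms(2,3) by (simp add: scalar_prod_def atLeast0LessThan)
  thus ?thesis using assms by (auto simp: orthogonal_group_def split: if_splits)
qed

lemma orthogonal_group_cols:
  assumes "X \<in> orthogonal_group n" "i < n" "j < n"
  shows "(\<Sum>k<n. X $$ (k, i) * X $$ (k, j)) = of_bool (i = j)"
proof -
  have X: "X \<in> carrier_mat n n" using assms by (simp add: orthogonal_group_def)
  have "(transpose_mat X * X) $$ (i, j) = (\<Sum>k<n. X $$ (k, i) * X $$ (k, j))"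
    using X assms(2,3) by (simp add: scalar_prod_def atLeast0LessThan)
  thus ?thesis using assms by (auto simp: orthogonal_group_def split: if_splits)
qed

lemma orthogonal_group_abs_le_1:
  assumes "X \<in> orthogonal_group n" "i < n" "k < n"
  shows "\<bar>X $$ (i, k)\<bar> \<le> 1"
proof -
  have "X $$ (i, k) * X $$ (i, k) \<le> (\<Sum>k<n. X $$ (i, k) * X $$ (i, k))"
    using assms by (intro member_le_sum) auto
  hence "(X $$ (i, k))\<^sup>2 \<le> 1"
    using orthogonal_group_rows[OF assms(1,2,2)] by (simp add: power2_eq_square)
  thus ?thesis by (simp add: abs_square_le_1)
qed

text \<open>\<open>conj_diag n g X i j\<close> is the \<open>(i, j)\<close> entry of \<open>X D X\<^sup>T\<close>, where \<open>D = diag(g 0, \<dots>, g (n - 1))\<close>.\<close>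

definition conj_diag :: "nat \<Rightarrow> (nat \<Rightarrow> real) \<Rightarrow> real mat \<Rightarrow> nat \<Rightarrow> nat \<Rightarrow> real" where
  "conj_diag n g X i j = (\<Sum>k<n. g k * (X $$ (i, k) * X $$ (j, k)))"

lemma conj_diag_commute: "conj_diag n g X i j = conj_diag n g X j i"
  by (simp add: conj_diag_def mult_ac)

lemma conj_diag_abs_le:
  assumes "X \<in> orthogonal_group n" "i < n" "j < n"
  shows "\<bar>conj_diag n g X i j\<bar> \<le> (\<Sum>k<n. \<bar>g k\<bar>)"
  unfolding conj_diag_def
proof (intro order.trans[OF sum_abs] sum_mono)
  fix k assume "k \<in> {..<n}"
  hence "\<bar>X $$ (i, k) * X $$ (j, k)\<bar> \<le> 1"
    using assms orthogonal_group_abs_le_1 by (auto simp: abs_mult intro!: mult_le_one)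
  thus "\<bar>g k * (X $$ (i, k) * X $$ (j, k))\<bar> \<le> \<bar>g k\<bar>"
    by (simp add: abs_mult mult_left_le)
qed

lemma conj_diag_trace:
  assumes "X \<in> orthogonal_group n"
  shows "(\<Sum>i<n. conj_diag n g X i i) = (\<Sum>k<n. g k)"
proof -
  have "(\<Sum>i<n. conj_diag n g X i i) = (\<Sum>k<n. g k * (\<Sum>i<n. X $$ (i, k) * X $$ (i, k)))"
    unfolding conj_diag_def by (subst sum.swap) (simp add: sum_distrib_left)
  thus ?thesis using orthogonal_group_cols[OF assms] by simp
qed

text \<open>Both sides are the (p, p) entry of (X D X^T)^2 = X D^2 X^T; orthonormality of the
  columns collapses the inner double sum.\<close>

lemma conj_diag_row_norm:
  assumes "X \<in> orthogonal_group n" "p < n"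
  shows "(\<Sum>q<n. (conj_diag n g X p q)\<^sup>2) = (\<Sum>k<n. (X $$ (p, k))\<^sup>2 * (g k)\<^sup>2)"
proof -
  have "(\<Sum>q<n. (conj_diag n g X p q)\<^sup>2) =
      (\<Sum>q<n. \<Sum>k<n. \<Sum>l<n. (g k * X $$ (p, k)) * (g l * X $$ (p, l)) * (X $$ (q, k) * X $$ (q, l)))"
    unfolding conj_diag_def power2_eq_square sum_product by (simp add: mult_ac)
  also have "\<dots> = (\<Sum>k<n. \<Sum>q<n. \<Sum>l<n. (g k * X $$ (p, k)) * (g l * X $$ (p, l)) * (X $$ (q, k) * X $$ (q, l)))"
    by (rule sum.swap)
  also have "\<dots> = (\<Sum>k<n. \<Sum>l<n. \<Sum>q<n. (g k * X $$ (p, k)) * (g l * X $$ (p, l)) * (X $$ (q, k) * X $$ (q, l)))"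
    by (intro sum.cong[OF refl] sum.swap)
  also have "\<dots> = (\<Sum>k<n. \<Sum>l<n. (g k * X $$ (p, k)) * (g l * X $$ (p, l)) * of_bool (k = l))"
    unfolding sum_distrib_left[symmetric]
    using orthogonal_group_cols[OF assms(1)] by (intro sum.cong refl) auto
  also have "\<dots> = (\<Sum>k<n. (X $$ (p, k))\<^sup>2 * (g k)\<^sup>2)"
    by (simp add: power2_eq_square mult_ac of_bool_def if_distrib sum.If_cases cong: if_cong)
  finally show ?thesis .
qed

text \<open>Von Neumann's trace inequality: the squared entries of \<open>X\<close> form a doubly stochastic matrix.\<close>

lemma conj_diag_weighted_norm_le:
  assumes X: "X \<in> orthogonal_group n"
    and b: "\<And>i. i < n \<Longrightarrow> 0 \<le> b i" "\<And>i j. i \<le> j \<Longrightarrow> j < n \<Longrightarrow> b j \<le> b i"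
    and g: "\<And>i. i < n \<Longrightarrow> 0 \<le> g i" "\<And>i j. i \<le> j \<Longrightarrow> j < n \<Longrightarrow> g j \<le> g i"
  shows "(\<Sum>p<n. (b p)\<^sup>2 * (\<Sum>q<n. (conj_diag n g X p q)\<^sup>2)) \<le> (\<Sum>i<n. (b i)\<^sup>2 * (g i)\<^sup>2)"
proof -
  have "(\<Sum>p<n. (b p)\<^sup>2 * (\<Sum>k<n. (X $$ (p, k))\<^sup>2 * (g k)\<^sup>2)) \<le> (\<Sum>i<n. (b i)\<^sup>2 * (g i)\<^sup>2)"
  proof (rule doubly_stochastic_bilinear_le)
    show "(\<Sum>k<n. (X $$ (p, k))\<^sup>2) = 1" if "p < n" for p
      using orthogonal_group_rows[OF X that that] by (simp add: power2_eq_square)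
    show "(\<Sum>k<n. (X $$ (k, p))\<^sup>2) = 1" if "p < n" for p
      using orthogonal_group_cols[OF X that that] by (simp add: power2_eq_square)
  qed (use b g in \<open>auto intro!: power_mono\<close>)
  thus ?thesis using conj_diag_row_norm[OF X] by simp
qed

text \<open>A rotation in the plane (p, q) leaves all diagonal entries but two unchanged, and
  preserves the sum of these two. Hence only the difference of the weights \<open>b p\<close> and
  \<open>b q\<close> enters. For p = q both sides are 0.\<close>

lemma conj_diag_givens_diff:
  fixes b g :: "nat \<Rightarrow> real"
  assumes X: "X \<in> carrier_mat n n" and pq: "p < n" "q < n" and cs: "c\<^sup>2 + s\<^sup>2 = 1"
  shows "(\<Sum>i<n. b i * conj_diag n g X i i) - (\<Sum>i<n. b i * conj_diag n g (givens n p q c s * X) i i) =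
    (b p - b q) * (s\<^sup>2 * (conj_diag n g X p p - conj_diag n g X q q) - 2 * c * s * conj_diag n g X p q)"
proof (cases "p = q")
  case True
  thus ?thesis using givens_mult_index[OF X pq] by (simp add: conj_diag_def)
next
  case False
  define M where "M = conj_diag n g X"
  define M' where "M' = conj_diag n g (givens n p q c s * X)"
  note ix = givens_mult_index[OF X pq]
  have other: "M' i i = M i i" if "i < n" "i \<noteq> p" "i \<noteq> q" for i
    using that False by (simp add: M_def M'_def conj_diag_def ix)
  have p: "M' p p = c\<^sup>2 * M p p + s\<^sup>2 * M q q + 2 * c * s * M p q"
    using pq False
    by (simp add: M_def M'_def conj_diag_def ix sum_distrib_left sum.distrib[symmetric] power2_eq_square algebra_simps)
  have q: "M' q q = s\<^sup>2 * M p p + c\<^sup>2 * M q q - 2 * c * s * M p q"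
    using pq False
    by (simp add: M_def M'_def conj_diag_def ix sum_distrib_left sum.distrib[symmetric] sum_subtractf[symmetric] power2_eq_square algebra_simps)
  have c2: "c\<^sup>2 = 1 - s\<^sup>2" using cs by simp
  have "(\<Sum>i<n. b i * M i i) - (\<Sum>i<n. b i * M' i i) = (\<Sum>i<n. b i * (M i i - M' i i))"
    by (simp add: sum_subtractf right_diff_distrib)
  also have "\<dots> = (\<Sum>i\<in>{p, q}. b i * (M i i - M' i i))"
    using pq other by (intro sum.mono_neutral_right) auto
  also have "\<dots> = b p * (M p p - M' p p) + b q * (M q q - M' q q)"
    using False by simp
  also have "\<dots> = (b p - b q) * (s\<^sup>2 * (M p p - M q q) - 2 * c * s * M p q)"
    unfolding p q c2 by (simp add: algebra_simps)
  finally show ?thesis by (simp add: M_def M'_def)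
qed

lemma sum_antisymmetric_eq_0:
  fixes h :: "'b \<Rightarrow> 'b \<Rightarrow> real"
  assumes "\<And>p q. h p q = - h q p"
  shows "(\<Sum>p\<in>A. \<Sum>q\<in>A. h p q) = 0"
proof -
  have "(\<Sum>p\<in>A. \<Sum>q\<in>A. h p q) = (\<Sum>p\<in>A. \<Sum>q\<in>A. h q p)" by (rule sum.swap)
  also have "\<dots> = - (\<Sum>p\<in>A. \<Sum>q\<in>A. h p q)" by (subst assms) (simp add: sum_negf)
  finally show ?thesis by simp
qed

text \<open>The eigenfunction property. The terms with off-diagonal entries are antisymmetric in (p,
  q) and cancel; in the remaining double sum the trace of X D X^T is constant, which produces the
  centring. The factor 2 n s^2 is the spectral gap summed over n^2 pairs.\<close>

lemma conj_diag_givens_sum_diff: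
  fixes b g :: "nat \<Rightarrow> real"
  assumes X: "X \<in> orthogonal_group n" and n: "n > 0" and cs: "c\<^sup>2 + s\<^sup>2 = 1"
  defines "f \<equiv> \<lambda>X. \<Sum>i<n. b i * conj_diag n g X i i"
  shows "(\<Sum>p<n. \<Sum>q<n. f X - f (givens n p q c s * X)) =
    2 * real n * s\<^sup>2 * (f X - (\<Sum>i<n. b i) * (\<Sum>i<n. g i) / real n)"
proof -
  define M where "M = conj_diag n g X"
  have X': "X \<in> carrier_mat n n" using X by (simp add: orthogonal_group_def)
  have tr: "(\<Sum>i<n. M i i) = (\<Sum>i<n. g i)" unfolding M_def by (rule conj_diag_trace[OF X])
  have anti: "(\<Sum>p<n. \<Sum>q<n. (b p - b q) * M p q) = 0"
    by (rule sum_antisymmetric_eq_0) (simp add: M_def conj_diag_commute[of n g X] minus_mult_left)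
  have "(\<Sum>p<n. \<Sum>q<n. f X - f (givens n p q c s * X)) =
      (\<Sum>p<n. \<Sum>q<n. s\<^sup>2 * ((b p - b q) * (M p p - M q q)) - 2 * c * s * ((b p - b q) * M p q))"
    unfolding f_def using conj_diag_givens_diff[OF X' _ _ cs]
    by (intro sum.cong refl) (simp add: M_def algebra_simps)
  also have "\<dots> = s\<^sup>2 * (\<Sum>p<n. \<Sum>q<n. (b p - b q) * (M p p - M q q)) - 2 * c * s * (\<Sum>p<n. \<Sum>q<n. (b p - b q) * M p q)"
    by (simp add: sum_subtractf sum_distrib_left)
  also have "(\<Sum>p<n. \<Sum>q<n. (b p - b q) * (M p p - M q q)) =
      2 * (real n * (\<Sum>p<n. b p * M p p) - (\<Sum>p<n. b p) * (\<Sum>p<n. M p p))"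
  proof -
    have "(\<Sum>p<n. \<Sum>q<n. (b p - b q) * (M p p - M q q)) =
      (\<Sum>p<n. \<Sum>q<n. b p * M p p) - (\<Sum>p<n. \<Sum>q<n. b p * M q q) - (\<Sum>p<n. \<Sum>q<n. b q * M p p) + (\<Sum>p<n. \<Sum>q<n. b q * M q q)"
      by (simp only: left_diff_distrib right_diff_distrib sum_subtractf sum.distrib)
    also have "(\<Sum>p<n. \<Sum>q<n. b q * M p p) = (\<Sum>p<n. \<Sum>q<n. b p * M q q)" by (rule sum.swap)
    also have "(\<Sum>p<n. \<Sum>q<n. b p * M q q) = (\<Sum>p<n. b p) * (\<Sum>p<n. M p p)" by (simp add: sum_product)
    finally show ?thesis by (simp add: sum_distrib_left sum_negf)
  qed
  also have "real n * (\<Sum>p<n. b p * M p p) - (\<Sum>p<n. b p) * (\<Sum>p<n. M p p) =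
      real n * (f X - (\<Sum>i<n. b i) * (\<Sum>i<n. g i) / real n)"
    unfolding tr using n by (simp add: f_def M_def right_diff_distrib)
  finally show ?thesis unfolding anti by simp
qed

text \<open>The increment is split into a part of order s^2 and a part of order s. The first is
  bounded crudely and, by \<open>small\<close>, contributes at most 4 s^2 S. The second contributes
  16 s^2 S through von Neumann's inequality, S being the sum of squared products.\<close>

lemma conj_diag_givens_sum_sq:
  fixes b g :: "nat \<Rightarrow> real"
  assumes X: "X \<in> orthogonal_group n" and cs: "c\<^sup>2 + s\<^sup>2 = 1"
    and b: "\<And>i. i < n \<Longrightarrow> 0 \<le> b i" "\<And>i j. i \<le> j \<Longrightarrow> j < n \<Longrightarrow> b j \<le> b i"
    and g: "\<And>i. i < n \<Longrightarrow> 0 \<le> g i" "\<And>i j. i \<le> j \<Longrightarrow> j < n \<Longrightarrow> g j \<le> g i"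
    and small: "s\<^sup>2 * (real n * real n * (b 0 * (2 * (\<Sum>i<n. g i)))\<^sup>2) \<le> 2 * (\<Sum>i<n. (b i)\<^sup>2 * (g i)\<^sup>2)"
  defines "f \<equiv> \<lambda>X. \<Sum>i<n. b i * conj_diag n g X i i"
  shows "(\<Sum>p<n. \<Sum>q<n. (f X - f (givens n p q c s * X))\<^sup>2) \<le> 20 * s\<^sup>2 * (\<Sum>i<n. (b i)\<^sup>2 * (g i)\<^sup>2)"
proof -
  define S where "S = (\<Sum>i<n. (b i)\<^sup>2 * (g i)\<^sup>2)"
  define M where "M = conj_diag n g X"
  define G where "G = (\<Sum>i<n. g i)"
  have X': "X \<in> carrier_mat n n" using X by (simp add: orthogonal_group_def)
  have G0: "G \<ge> 0" unfolding G_def using g by (intro sum_nonneg) auto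
  have c1: "c\<^sup>2 \<le> 1" using cs zero_le_power2[of s] by linarith
  have sq: "(x - y)\<^sup>2 \<le> 2 * x\<^sup>2 + 2 * y\<^sup>2" for x y :: real
    using zero_le_power2[of "x + y"] by (simp add: power2_eq_square algebra_simps)
  have sq0: "(x - y)\<^sup>2 \<le> x\<^sup>2 + y\<^sup>2" if "x \<ge> 0" "y \<ge> 0" for x y :: real
    using that by (simp add: power2_diff)
  have "(f X - f (givens n p q c s * X))\<^sup>2 \<le>
      2 * s\<^sup>2 * (s\<^sup>2 * (b 0 * (2 * G))\<^sup>2) + 8 * s\<^sup>2 * (((b p)\<^sup>2 + (b q)\<^sup>2) * (M p q)\<^sup>2)" if pq: "p < n" "q < n" for p q
  proof -
    have "(f X - f (givens n p q c s * X))\<^sup>2 =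
        (s * (s * ((b p - b q) * (M p p - M q q))) - 2 * c * s * ((b p - b q) * M p q))\<^sup>2"
      unfolding f_def conj_diag_givens_diff[OF X' pq cs] M_def
      by (simp add: power2_eq_square algebra_simps)
    also have "\<dots> \<le> 2 * (s * (s * ((b p - b q) * (M p p - M q q))))\<^sup>2 + 2 * (2 * c * s * ((b p - b q) * M p q))\<^sup>2"
      by (rule sq)
    also have "\<dots> = 2 * s\<^sup>2 * (s\<^sup>2 * ((b p - b q) * (M p p - M q q))\<^sup>2) + 8 * s\<^sup>2 * (c\<^sup>2 * ((b p - b q)\<^sup>2 * (M p q)\<^sup>2))"
      by (simp add: power_mult_distrib)
    also have "((b p - b q) * (M p p - M q q))\<^sup>2 \<le> (b 0 * (2 * G))\<^sup>2"
    proof (rule power2_le_iff_abs_le[THEN iffD2])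
      \<comment> \<open>All weights lie between 0 and the largest one, \<open>b 0\<close>.\<close>
      have "\<bar>b p - b q\<bar> \<le> b 0" using b(1)[of p] b(1)[of q] b(2)[of 0 p] b(2)[of 0 q] pq by linarith
      moreover have "(\<Sum>k<n. \<bar>g k\<bar>) = G" unfolding G_def using g by (intro sum.cong) auto
      hence "\<bar>M p p\<bar> \<le> G" "\<bar>M q q\<bar> \<le> G"
        using conj_diag_abs_le[OF X, of _ _ g] pq by (auto simp: M_def)
      hence "\<bar>M p p - M q q\<bar> \<le> 2 * G" by linarith
      ultimately show "\<bar>(b p - b q) * (M p p - M q q)\<bar> \<le> b 0 * (2 * G)"
        unfolding abs_mult by (intro mult_mono) auto
      show "b 0 * (2 * G) \<ge> 0" using G0 b(1)[of 0] pq by auto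
    qed
    \<comment> \<open>Nonnegativity of the weights drops the mixed term, so (b p - b q)^2 is bounded
      without a factor 2.\<close>
    also have "c\<^sup>2 * ((b p - b q)\<^sup>2 * (M p q)\<^sup>2) \<le> 1 * (((b p)\<^sup>2 + (b q)\<^sup>2) * (M p q)\<^sup>2)"
      using cs b pq by (intro mult_mono mult_right_mono sq0 c1) auto
    finally show ?thesis by (simp add: mult_left_mono)
  qed
  hence "(\<Sum>p<n. \<Sum>q<n. (f X - f (givens n p q c s * X))\<^sup>2) \<le>
      (\<Sum>p<n. \<Sum>q<n. 2 * s\<^sup>2 * (s\<^sup>2 * (b 0 * (2 * G))\<^sup>2) + 8 * s\<^sup>2 * (((b p)\<^sup>2 + (b q)\<^sup>2) * (M p q)\<^sup>2))"
    by (intro sum_mono) auto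
  also have "\<dots> = 2 * s\<^sup>2 * (s\<^sup>2 * (real n * real n * (b 0 * (2 * G))\<^sup>2)) +
      8 * s\<^sup>2 * (\<Sum>p<n. \<Sum>q<n. ((b p)\<^sup>2 + (b q)\<^sup>2) * (M p q)\<^sup>2)"
    by (simp add: sum.distrib sum_distrib_left mult_ac)
  also have "(\<Sum>p<n. \<Sum>q<n. ((b p)\<^sup>2 + (b q)\<^sup>2) * (M p q)\<^sup>2) = 2 * (\<Sum>p<n. (b p)\<^sup>2 * (\<Sum>q<n. (M p q)\<^sup>2))"
  proof -
    have "(\<Sum>p<n. \<Sum>q<n. (b q)\<^sup>2 * (M p q)\<^sup>2) = (\<Sum>p<n. \<Sum>q<n. (b p)\<^sup>2 * (M p q)\<^sup>2)"
      by (subst sum.swap) (simp add: M_def conj_diag_commute[of n g X])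
    thus ?thesis by (simp add: distrib_right sum.distrib sum_distrib_left)
  qed
  also have "(\<Sum>p<n. (b p)\<^sup>2 * (\<Sum>q<n. (M p q)\<^sup>2)) \<le> S"
    unfolding M_def S_def by (rule conj_diag_weighted_norm_le[OF X b g])
  also have "s\<^sup>2 * (real n * real n * (b 0 * (2 * G))\<^sup>2) \<le> 2 * S"
    using small by (simp add: G_def S_def)
  finally show ?thesis by (simp add: S_def mult_left_mono)
qed

subsection \<open>Diagonalization of real symmetric matrices\<close>

lemma prod_proots_dvd:
  fixes p :: "'a :: field poly"
  assumes "p \<noteq> 0"
  shows "(\<Prod>x\<in>#proots p. [:- x, 1:]) dvd p"
  using assms
proof (induction "degree p" arbitrary: p rule: less_induct)
  case less
  show ?case
  proof (cases "\<exists>a. poly p a = 0")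
    case False
    hence "proots p = {#}"
      using less.prems by (auto simp: set_mset_eq_empty_iff[symmetric] simp del: set_mset_eq_empty_iff)
    thus ?thesis by simp
  next
    case True
    then obtain a q where p: "p = [:- a, 1:] * q"
      by (auto simp: poly_eq_0_iff_dvd dvd_def)
    have q: "q \<noteq> 0" using less.prems p by auto
    have "degree p = Suc (degree q)" unfolding p using q by (subst degree_mult_eq) auto
    hence "(\<Prod>x\<in>#proots q. [:- x, 1:]) dvd q" using less.hyps q by auto
    moreover have "proots p = {#a#} + proots q"
      unfolding p using q by (subst proots_mult) auto
    hence "(\<Prod>x\<in>#proots p. [:- x, 1:]) = [:- a, 1:] * (\<Prod>x\<in>#proots q. [:- x, 1:])"
      by (simp del: mult_pCons_left)
    ultimately show ?thesis unfolding p by (simp only: mult_dvd_mono dvd_refl)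
  qed
qed

text \<open>With as many roots as its degree, the polynomial has a constant quotient by the product
  of its linear factors; comparing leading coefficients gives 1.\<close>

lemma monic_eq_prod_proots:
  fixes p :: "'a :: field poly"
  assumes "monic p" "size (proots p) = degree p"
  shows "p = (\<Prod>x\<in>#proots p. [:- x, 1:])"
proof -
  define r where "r = (\<Prod>x\<in>#proots p. [:- x, 1:])"
  have p0: "p \<noteq> 0" using assms(1) by auto
  have r: "monic (\<Prod>x\<in>#A. [:- x, 1:]) \<and> degree (\<Prod>x\<in>#A. [:- x, 1:]) = size A" for A :: "'a multiset"
  proof (induction A)
    case (add a A)
    hence "(\<Prod>x\<in>#A. [:- x, 1:]) \<noteq> 0" by auto
    hence "degree ([:- a, 1:] * (\<Prod>x\<in>#A. [:- x, 1:])) = Suc (size A)"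
      using add by (subst degree_mult_eq) auto
    moreover have "monic ([:- a, 1:] * (\<Prod>x\<in>#A. [:- x, 1:]))"
      using conjunct1[OF add.IH] unfolding lead_coeff_mult by (simp only:) simp
    ultimately show ?case by (simp del: mult_pCons_left)
  qed simp
  from prod_proots_dvd[OF p0] obtain s where s: "p = r * s" by (auto simp: r_def dvd_def)
  hence "r \<noteq> 0" "s \<noteq> 0" using p0 by auto
  hence "degree p = degree r + degree s" unfolding s by (rule degree_mult_eq)
  hence "degree s = 0" using r[of "proots p"] assms(2) by (simp add: r_def)
  then obtain c where c: "s = [:c:]" by (metis degree_eq_zeroE)
  have lr: "lead_coeff r = 1" unfolding r_def using r by blast
  have "lead_coeff p = lead_coeff r * lead_coeff s" unfolding s by (rule lead_coeff_mult)
  hence "c = 1" unfolding lr assms(1) c by simp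
  thus ?thesis using s c by (simp add: r_def)
qed

text \<open>The n listed real roots exhaust the degree, so the characteristic polynomial splits.
  Keeping them as a list fixes the order in which the diagonalization will reproduce them.\<close>

lemma eigenvalues_desc_char_poly:
  assumes "eigenvalues_desc n M \<beta>" "M \<in> carrier_mat n n"
  shows "char_poly M = (\<Prod>e\<leftarrow>map \<beta> [1..<Suc n]. [:- e, 1:])"
proof -
  have *: "mset (map \<beta> [1..<Suc n]) = proots (char_poly M)"
    using assms(1) by (simp only: eigenvalues_desc_def mset_map mset_upt atLeastLessThanSuc_atLeastAtMost)
  have "size (proots (char_poly M)) = n" unfolding *[symmetric] by simp
  hence "char_poly M = (\<Prod>x\<in>#proots (char_poly M). [:- x, 1:])"
    using degree_monic_char_poly[OF assms(2)] by (intro monic_eq_prod_proots) auto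
  thus ?thesis unfolding *[symmetric] by (simp add: prod_mset_prod_list flip: mset_map)
qed

section \<open>Spectral theorem by deflation\<close>

lemma orthogonal_group_with_first_column:
  fixes v :: "real vec"
  assumes v: "v \<in> carrier_vec n" "v \<bullet> v = 1" and n: "0 < n"
  shows "\<exists>H\<in>orthogonal_group n. col H 0 = v"
proof (cases "v = unit_vec n 0")
  case True
  have "1\<^sub>m n \<in> orthogonal_group n" by (simp add: orthogonal_group_def)
  thus ?thesis using True n by (intro bexI[of _ "1\<^sub>m n"]) auto
next
  case False
  \<comment> \<open>\<open>H\<close> is the Householder reflection that exchanges \<open>v\<close> and the first unit vector.\<close>
  define w where "w = (\<lambda>i. of_bool (i = 0) - v $ i)"
  \<comment> \<open>As w has squared norm 2 (1 - v_0), this is 2 / |w|^2, the coefficient that makes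
    I - a w w^T a reflection. A unit vector with v_0 = 1 would be the first unit vector, so the
    denominator is nonzero.\<close>
  define a where "a = 1 / (1 - v $ 0)"
  define H where "H = mat n n (\<lambda>(i, j). of_bool (i = j) - a * w i * w j)"
  have vv: "(\<Sum>k<n. v $ k * v $ k) = 1" using v by (simp add: scalar_prod_def atLeast0LessThan)
  have v0: "v $ 0 \<noteq> 1"
  proof
    assume 1: "v $ 0 = 1"
    have "(\<Sum>k\<in>{..<n} - {0}. v $ k * v $ k) = 0"
      using vv n 1 by (subst (asm) sum.remove[of _ 0]) auto
    hence "\<forall>k\<in>{..<n} - {0}. v $ k * v $ k = 0" by (subst (asm) sum_nonneg_eq_0_iff) auto
    hence "v = unit_vec n 0" using v 1 by (intro eq_vecI) (auto simp: unit_vec_def)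
    thus False using False by simp
  qed
  have ww: "(\<Sum>k<n. w k * w k) = 2 * (1 - v $ 0)"
  proof -
    have "(\<Sum>k<n. w k * w k) = (\<Sum>k<n. (if k = 0 then 1 - 2 * v $ 0 else 0) + v $ k * v $ k)"
      unfolding w_def by (intro sum.cong) (auto simp: algebra_simps)
    thus ?thesis using vv n by (simp add: sum.distrib)
  qed
  have "1 - v $ 0 \<noteq> 0" using v0 by simp
  hence aww: "a * (\<Sum>k<n. w k * w k) = 2" unfolding ww a_def by (simp add: field_simps)
  have Hc: "H \<in> carrier_mat n n" by (simp add: H_def)
  have Ht: "transpose_mat H = H" by (rule eq_matI) (auto simp: H_def mult_ac)
  have "H * H = 1\<^sub>m n"
  proof (rule eq_matI)
    fix i j assume "i < dim_row (1\<^sub>m n :: real mat)" "j < dim_col (1\<^sub>m n :: real mat)"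
    hence ij: "i < n" "j < n" by auto
    have "(H * H) $$ (i, j) = (\<Sum>k<n. (of_bool (i = k) - a * w i * w k) * (of_bool (k = j) - a * w k * w j))"
      using ij by (simp add: H_def scalar_prod_def atLeast0LessThan)
    also have "\<dots> = (\<Sum>k<n. (if k = i then of_bool (k = j) - a * w i * w j else 0) - (if k = j then a * w i * w j else 0)
        + a * w i * w j * (a * (w k * w k)))"
      by (intro sum.cong) (auto simp: algebra_simps)
    also have "\<dots> = of_bool (i = j) - 2 * (a * w i * w j) + a * w i * w j * (a * (\<Sum>k<n. w k * w k))"
      using ij by (simp add: sum.distrib sum_subtractf sum_distrib_left)
    finally show "(H * H) $$ (i, j) = 1\<^sub>m n $$ (i, j)"
      unfolding aww using ij by simp
  qed (simp_all add: H_def)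
  hence "H \<in> orthogonal_group n" using Hc Ht by (simp add: orthogonal_group_def)
  moreover have "col H 0 = v"
    using v v0 n by (intro eq_vecI) (auto simp: H_def w_def a_def field_simps)
  ultimately show ?thesis by blast
qed

text \<open>Deflation along the list of roots: a unit eigenvector for the head becomes the first
  column of an orthogonal \<open>H\<close>, symmetry makes H^T A H block diagonal, and the lower
  block has the tail as its roots. The diagonal comes out in the order of \<open>es\<close>.\<close>

lemma real_symmetric_diagonalization:
  fixes A :: "real mat"
  assumes "A \<in> carrier_mat n n" "transpose_mat A = A" "char_poly A = (\<Prod>e\<leftarrow>es. [:- e, 1:])"
  shows "\<exists>W\<in>orthogonal_group n. A = W * mat_diag n (\<lambda>i. es ! i) * transpose_mat W"
  using assms
proof (induction es arbitrary: n A)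
  case Nil
  hence "n = 0" using degree_monic_char_poly[OF Nil(1)] by simp
  thus ?case using Nil(1) by (intro bexI[of _ "1\<^sub>m 0"]) (auto simp: orthogonal_group_def intro!: eq_matI)
next
  case (Cons e es N A)
  note A = Cons.prems(1) and sym = Cons.prems(2) and cp = Cons.prems(3)
  have "poly (char_poly A) e = 0" unfolding cp by simp
  hence ev: "eigenvalue A e" using eigenvalue_root_char_poly[OF A] by simp
  then obtain v where v: "v \<in> carrier_vec N" "v \<noteq> 0\<^sub>v N" "A *\<^sub>v v = e \<cdot>\<^sub>v v"
    using A by (auto simp: eigenvalue_def eigenvector_def)
  have "N \<noteq> 0" using v by auto
  then obtain n where N: "N = Suc n" by (cases N) auto
  define u where "u = (1 / sqrt (v \<bullet> v)) \<cdot>\<^sub>v v"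
  have "v \<bullet> v > 0"
    using conjugate_square_greater_0_vec[OF v(1)] v(2) by (simp add: scalar_prod_def)
  hence u: "u \<in> carrier_vec N" "u \<bullet> u = 1" "A *\<^sub>v u = e \<cdot>\<^sub>v u"
    using v A by (simp_all add: u_def mult_mat_vec[OF A] smult_smult_assoc mult.commute power2_eq_square[symmetric])
  obtain H where H: "H \<in> orthogonal_group N" "col H 0 = u"
    using orthogonal_group_with_first_column[OF u(1,2)] N by auto
  have Hc: "H \<in> carrier_mat N N" and HtH: "transpose_mat H * H = 1\<^sub>m N" and HHt: "H * transpose_mat H = 1\<^sub>m N"
    using H by (auto simp: orthogonal_group_def)
  have Htc: "transpose_mat H \<in> carrier_mat N N" using Hc by simp
  note assoc = assoc_mult_mat[of _ N N _ N _ N]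
  define B where "B = transpose_mat H * A * H"
  have B: "B \<in> carrier_mat N N" using Hc A by (simp add: B_def)
  have Bsym: "transpose_mat B = B"
    using A Hc sym by (simp add: B_def transpose_mult[of _ N N _ N] assoc)
  have AB: "A = H * B * transpose_mat H"
  proof -
    have "H * B * transpose_mat H = (H * transpose_mat H) * A * (H * transpose_mat H)"
      using A Hc Htc by (simp add: B_def assoc del: HHt)
    thus ?thesis using A HHt by simp
  qed
  \<comment> \<open>The first column of B is H^T A u = e H^T u, that is, e times the first unit
    vector; symmetry gives the first row.\<close>
  have col0: "B $$ (i, 0) = (if i = 0 then e else 0)" if i: "i < N" for i
  proof -
    have "B $$ (i, 0) = (transpose_mat H * (A * H)) $$ (i, 0)"
      using A Hc Htc by (simp add: B_def assoc)
    also have "\<dots> = col H i \<bullet> col (A * H) 0" using A Hc i by simp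
    also have "col (A * H) 0 = e \<cdot>\<^sub>v col H 0"
      using col_mult2[OF A Hc, of 0] N u H by simp
    also have "col H i \<bullet> (e \<cdot>\<^sub>v col H 0) = e * (transpose_mat H * H) $$ (i, 0)"
      using Hc i N by simp
    finally show ?thesis unfolding HtH using i N by simp
  qed
  have row0: "B $$ (0, i) = (if i = 0 then e else 0)" if "i < N" for i
    using col0[OF that] arg_cong[OF Bsym, of "\<lambda>M. M $$ (i, 0)"] B N that by simp
  define B3 where "B3 = mat n n (\<lambda>(i, j). B $$ (Suc i, Suc j))"
  have B3: "B3 \<in> carrier_mat n n" by (simp add: B3_def)
  have blk: "B = four_block_mat (mat 1 1 (\<lambda>_. e)) (0\<^sub>m 1 n) (0\<^sub>m n 1) B3"
    using B N col0 row0 by (intro eq_matI) (auto simp: B3_def)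
  have "transpose_mat B3 = B3"
  proof (rule eq_matI)
    fix i j assume "i < dim_row B3" "j < dim_col B3"
    thus "transpose_mat B3 $$ (i, j) = B3 $$ (i, j)"
      using arg_cong[OF Bsym, of "\<lambda>M. M $$ (Suc i, Suc j)"] B N by (simp add: B3_def)
  qed (simp_all add: B3_def)
  moreover have "char_poly B3 = (\<Prod>e\<leftarrow>es. [:- e, 1:])"
  proof -
    have "similar_mat_wit A B H (transpose_mat H)"
      using AB A B Hc Htc HHt HtH by (intro similar_mat_witI[of _ _ N]) auto
    hence "char_poly A = char_poly B" by (intro char_poly_similar) (auto simp: similar_mat_def)
    also have "\<dots> = char_poly (mat 1 1 (\<lambda>_. e)) * char_poly B3"
      unfolding blk by (rule char_poly_four_block_zeros_col) (use B3 in auto)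
    also have "char_poly (mat 1 1 (\<lambda>_. e)) = [:- e, 1:]"
      by (subst char_poly_upper_triangular[of _ 1]) (auto simp: diag_mat_def)
    \<comment> \<open>Similarity preserves the characteristic polynomial, so the linear factor of e
      cancels and the lower block satisfies the induction hypothesis.\<close>
    finally have "[:- e, 1:] * (\<Prod>e\<leftarrow>es. [:- e, 1:]) = [:- e, 1:] * char_poly B3"
      unfolding cp by simp
    thus ?thesis by (subst (asm) mult_left_cancel) auto
  qed
  ultimately obtain W where W: "W \<in> orthogonal_group n" and BW: "B3 = W * mat_diag n (\<lambda>i. es ! i) * transpose_mat W"
    using Cons.IH[OF B3] by auto
  have Wc: "W \<in> carrier_mat n n" "transpose_mat W \<in> carrier_mat n n"
    using W by (auto simp: orthogonal_group_def)
  \<comment> \<open>The diagonalizing matrix of the lower block, bordered by a 1; the product of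
    \<open>H\<close> and \<open>K\<close> diagonalizes \<open>A\<close>.\<close>
  define K where "K = four_block_mat (1\<^sub>m 1) (0\<^sub>m 1 n) (0\<^sub>m n 1) W"
  have Kt: "transpose_mat K = four_block_mat (1\<^sub>m 1) (0\<^sub>m 1 n) (0\<^sub>m n 1) (transpose_mat W)"
    unfolding K_def using Wc by (subst transpose_four_block_mat[of _ 1 1 _ n _ n]) auto
  note mult_blk = mult_four_block_mat[of _ 1 1 _ n _ n _ _ 1 _ n]
  have K: "K \<in> orthogonal_group N"
  proof -
    have "transpose_mat K * K = four_block_mat (1\<^sub>m 1) (0\<^sub>m 1 n) (0\<^sub>m n 1) (transpose_mat W * W)"
      unfolding Kt unfolding K_def using Wc by (subst mult_blk) auto
    moreover have "K * transpose_mat K = four_block_mat (1\<^sub>m 1) (0\<^sub>m 1 n) (0\<^sub>m n 1) (W * transpose_mat W)"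
      unfolding Kt unfolding K_def using Wc by (subst mult_blk) auto
    moreover have "K \<in> carrier_mat N N" unfolding K_def N using Wc by auto
    ultimately show ?thesis using W by (simp add: orthogonal_group_def N)
  qed
  have Kc: "K \<in> carrier_mat N N" "transpose_mat K \<in> carrier_mat N N"
    using K by (auto simp: orthogonal_group_def)
  define D where "D = mat_diag N (\<lambda>i. (e # es) ! i)"
  have Dc: "D \<in> carrier_mat N N" by (simp add: D_def)
  have D: "D = four_block_mat (mat 1 1 (\<lambda>_. e)) (0\<^sub>m 1 n) (0\<^sub>m n 1) (mat_diag n (\<lambda>i. es ! i))"
    unfolding D_def N by (rule eq_matI) (auto simp: mat_diag_def nth_Cons')
  have WD: "W * mat_diag n (\<lambda>i. es ! i) \<in> carrier_mat n n"
    using Wc by (intro mult_carrier_mat[of _ n n _ n]) auto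
  have "K * D = four_block_mat (mat 1 1 (\<lambda>_. e)) (0\<^sub>m 1 n) (0\<^sub>m n 1) (W * mat_diag n (\<lambda>i. es ! i))"
    unfolding K_def D using Wc WD by (subst mult_blk) (auto simp: left_mult_zero_mat[OF mat_diag_dim])
  hence "K * D * transpose_mat K = B"
    unfolding blk BW Kt using Wc WD by (simp only:) (subst mult_blk, auto simp: left_mult_zero_mat[OF Wc(2)] right_mult_zero_mat[OF WD])
  hence "A = (H * K) * D * transpose_mat (H * K)"
    using AB Hc Kc Dc by (simp add: transpose_mult[of _ N N _ N] assoc flip: \<open>K * D * transpose_mat K = B\<close>)
  thus ?case unfolding D_def using orthogonal_group_mult[OF H(1) K] by blast
qed

subsection \<open>Concentration of the conjugated trace\<close>

text \<open>The random walk of Givens rotations is fed into the exchangeable pair bound, once for f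
  and once for -f, and a union bound joins the two tails.\<close>

lemma haar_quadratic_form_tail_bound:
  assumes \<mu>: "haar_prob_orthogonal n \<mu>" and n: "0 < n"
    and W: "W \<in> orthogonal_group n" and Z: "Z \<in> orthogonal_group n"
    and b: "\<And>i. i < n \<Longrightarrow> 0 \<le> b i" "\<And>i j. i \<le> j \<Longrightarrow> j < n \<Longrightarrow> b j \<le> b i"
    and g: "\<And>i. i < n \<Longrightarrow> 0 \<le> g i" "\<And>i j. i \<le> j \<Longrightarrow> j < n \<Longrightarrow> g j \<le> g i"
    and \<epsilon>: "\<epsilon> \<ge> 0"
  defines "S \<equiv> (\<Sum>i<n. (b i)\<^sup>2 * (g i)\<^sup>2)"
    and "f \<equiv> \<lambda>U. (\<Sum>i<n. b i * conj_diag n g (transpose_mat W * U * Z) i i) - (\<Sum>i<n. b i) * (\<Sum>i<n. g i) / real n"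
  shows "f \<in> borel_measurable \<mu>"
    and "measure \<mu> {U \<in> space \<mu>. \<bar>f U\<bar> \<le> \<epsilon> * sqrt S} \<ge> 1 - 2 * exp (- (1 / 80) * real n * \<epsilon>\<^sup>2)"
proof -
  define G where "G = (\<Sum>i<n. g i)"
  define Y where "Y = (\<lambda>U. transpose_mat W * U * Z)"
  define h where "h = (\<lambda>X. \<Sum>i<n. b i * conj_diag n g X i i)"
  have f_alt: "f U = h (Y U) - (\<Sum>i<n. b i) * G / real n" for U
    by (simp add: f_def h_def Y_def G_def)
  have sp: "space \<mu> = orthogonal_group n" using \<mu> by (simp add: haar_prob_orthogonal_def)
  interpret prob_space \<mu> using \<mu> by (simp add: haar_prob_orthogonal_def)
  have Wt: "transpose_mat W \<in> orthogonal_group n" by (rule orthogonal_group_transpose[OF W])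
  have carr: "U \<in> carrier_mat n n" if "U \<in> orthogonal_group n" for U
    using that by (simp add: orthogonal_group_def)
  have Y: "Y U \<in> orthogonal_group n" if "U \<in> orthogonal_group n" for U
    unfolding Y_def using that W Z by (intro orthogonal_group_mult orthogonal_group_transpose)
  have entry: "(\<lambda>U. U $$ (i, j)) \<in> borel_measurable \<mu>" if "i < n" "j < n" for i j
    by (rule haar_measurable_of_continuous_map[OF \<mu> continuous_map_orthogonal_entry[OF that]])
  have Ym: "(\<lambda>U. Y U $$ (i, k)) \<in> borel_measurable \<mu>" if "i < n" "k < n" for i k
  proof -
    have "(\<lambda>U. \<Sum>j<n. W $$ (j, i) * (\<Sum>l<n. U $$ (j, l) * Z $$ (l, k))) \<in> borel_measurable \<mu>"
      using that by (intro borel_measurable_sum borel_measurable_times borel_measurable_const entry) auto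
    moreover have "Y U $$ (i, k) = (\<Sum>j<n. W $$ (j, i) * (\<Sum>l<n. U $$ (j, l) * Z $$ (l, k)))" if "U \<in> space \<mu>" for U
      using carr[OF W] carr[OF Z] carr[of U] that \<open>i < n\<close> \<open>k < n\<close>
      by (simp add: Y_def sp scalar_prod_def atLeast0LessThan)
    ultimately show ?thesis by (subst measurable_cong) auto
  qed
  have hm: "(\<lambda>U. h (Y U)) \<in> borel_measurable \<mu>"
    unfolding h_def conj_diag_def
    by (intro borel_measurable_sum borel_measurable_times borel_measurable_const Ym) auto
  show fm: "f \<in> borel_measurable \<mu>"
    unfolding f_alt[abs_def] using hm by measurable
  note [measurable] = fm
  have bf: "\<bar>f U\<bar> \<le> (\<Sum>i<n. b i) * G + \<bar>(\<Sum>i<n. b i) * G / real n\<bar>" if "U \<in> space \<mu>" for U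
  proof -
    have gG: "(\<Sum>k<n. \<bar>g k\<bar>) = G" unfolding G_def using g by (intro sum.cong) auto
    have "\<bar>h (Y U)\<bar> \<le> (\<Sum>i<n. b i * G)"
      unfolding h_def
    proof (intro order.trans[OF sum_abs] sum_mono)
      fix i assume "i \<in> {..<n}"
      thus "\<bar>b i * conj_diag n g (Y U) i i\<bar> \<le> b i * G"
        using conj_diag_abs_le[OF Y, of U i i g] that b gG by (auto simp: abs_mult sp intro!: mult_left_mono)
    qed
    hence "\<bar>h (Y U)\<bar> \<le> (\<Sum>i<n. b i) * G" by (simp add: sum_distrib_right)
    thus ?thesis unfolding f_alt by (rule order.trans[OF abs_triangle_ineq4 add_right_mono])
  qed
  have S0: "S \<ge> 0" unfolding S_def by (intro sum_nonneg) auto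
  show "measure \<mu> {U \<in> space \<mu>. \<bar>f U\<bar> \<le> \<epsilon> * sqrt S} \<ge> 1 - 2 * exp (- (1 / 80) * real n * \<epsilon>\<^sup>2)"
  proof (cases "S = 0")
    case True
    \<comment> \<open>If S vanishes, so does the product of the two largest values; by monotonicity
      and nonnegativity one whole sequence is 0, and so is f.\<close>
    have "(b 0)\<^sup>2 * (g 0)\<^sup>2 = 0"
      using True n unfolding S_def by (subst (asm) sum_nonneg_eq_0_iff) auto
    hence "b 0 = 0 \<or> g 0 = 0" by simp
    hence "(\<forall>i<n. b i = 0) \<or> (\<forall>i<n. g i = 0)"
      using b g by (metis antisym bot_nat_0.extremum)
    hence "f U = 0" for U
      by (auto simp: f_def conj_diag_def)
    thus ?thesis using True prob_space by simp
  next
    case False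
    with S0 have S: "S > 0" by simp
    \<comment> \<open>The sine \<open>s\<close> has to be small enough for \<open>S\<close> to dominate the terms of order \<open>s\<^sup>4\<close> in the squared
      increments, whose sum is at most \<open>2 s\<^sup>4 K\<close>.\<close>
    define K where "K = real n * real n * (b 0 * (2 * G))\<^sup>2"
    have K0: "K \<ge> 0" by (simp add: K_def)
    define s where "s = sqrt (2 * S / (K + 2 * S))"
    define c where "c = sqrt (1 - s\<^sup>2)"
    have s2: "s\<^sup>2 = 2 * S / (K + 2 * S)" "s\<^sup>2 > 0" "s\<^sup>2 \<le> 1"
      using S K0 by (simp_all add: s_def field_simps)
    hence cs: "c\<^sup>2 + s\<^sup>2 = 1" by (simp add: c_def)
    have small: "s\<^sup>2 * K \<le> 2 * S"
      unfolding s2(1) using S K0 by (simp add: field_simps)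
    \<comment> \<open>Conjugation by \<open>W\<close> makes left multiplication of U by
      \<open>V (p, q)\<close> act on Y = W^T U Z as left multiplication by the Givens rotation
      itself.\<close>
    define V where "V = (\<lambda>(p, q). W * givens n p q c s * transpose_mat W)"
    define I where "I = {..<n} \<times> {..<n}"
    have Gi: "givens n p q c s \<in> orthogonal_group n" if "p < n" "q < n" for p q
      using that by (intro givens_orthogonal cs)
    have VI: "V i \<in> orthogonal_group n" if "i \<in> I" for i
      using that Gi by (auto simp: V_def I_def intro!: orthogonal_group_mult W Wt)
    \<comment> \<open>Swapping the pair transposes the rotation, so \<open>prod.swap\<close> matches
      each move with its inverse.\<close>
    have Vinv: "V (prod.swap i) * (V i * U) = U" if i: "i \<in> I" and U: "U \<in> orthogonal_group n" for i U
    proof -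
      obtain p q where pq: "i = (p, q)" "p < n" "q < n" using i by (auto simp: I_def)
      have "V (prod.swap i) = transpose_mat (V i)"
        using transpose_mult[OF mult_carrier_mat[OF carr[OF W] givens_carrier] carr[OF Wt]]
        by (simp add: V_def pq transpose_mult[OF carr[OF W] givens_carrier] givens_transpose
          assoc_mult_mat[OF carr[OF W] givens_carrier carr[OF Wt]])
      thus ?thesis using orthogonal_group_transpose_cancel(2)[OF VI[OF i] carr[OF U]] by simp
    qed
    have YV: "Y (V (p, q) * U) = givens n p q c s * Y U" if "p < n" "q < n" "U \<in> orthogonal_group n" for p q U
    proof -
      define R where "R = givens n p q c s"
      have "R \<in> carrier_mat n n" by (simp add: R_def)
      note c1 = this carr[OF W] carr[OF Wt] carr[OF Z] carr[OF that(3)]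
      have "Y (V (p, q) * U) = (transpose_mat W * W) * R * (transpose_mat W * U * Z)"
        using c1 by (simp add: Y_def V_def R_def[symmetric] assoc_mult_mat[of _ n n _ n _ n])
      also have "transpose_mat W * W = 1\<^sub>m n" using W by (simp add: orthogonal_group_def)
      also have "1\<^sub>m n * R = R" using c1(1) by simp
      finally show ?thesis by (simp only: Y_def R_def)
    qed
    have tail: "prob {U \<in> space \<mu>. t * f U \<ge> \<epsilon> * sqrt S} \<le> exp (- (1 / 80) * real n * \<epsilon>\<^sup>2)"
      if t: "\<bar>t\<bar> = 1" for t
    proof -
      \<comment> \<open>The ratio of the bound 20 s^2 S on the squared increments to the gap 2 n
        s^2. The sine s cancels, so taking it small costs nothing in the constant.\<close>
      define v where "v = 10 * S / real n"
      have v: "v > 0" using S n by (simp add: v_def)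
      have der: "expectation (\<lambda>U. t * f U * exp (x * (t * f U))) \<le> x * v * expectation (\<lambda>U. exp (x * (t * f U)))"
        if x: "x \<ge> 0" for x
      proof -
        have "2 * real n * s\<^sup>2 * expectation (\<lambda>U. t * f U * exp (x * (t * f U)))
            \<le> x * (20 * s\<^sup>2 * S) * expectation (\<lambda>U. exp (x * (t * f U)))"
        proof (rule exchangeable_pair_mgf_bound[where I = I and T = "\<lambda>i U. V i * U" and \<iota> = prod.swap])
          show "finite I" by (simp add: I_def)
          show "(\<lambda>U. V i * U) \<in> measurable \<mu> \<mu>" if "i \<in> I" for i
            by (rule haar_measurable_mult[OF \<mu> VI[OF that]])
          show "distr \<mu> \<mu> (\<lambda>U. V i * U) = \<mu>" if "i \<in> I" for i
            by (rule haar_distr_mult[OF \<mu> VI[OF that]])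
          show "bij_betw prod.swap I I"
            by (rule bij_betwI[of _ _ _ prod.swap]) (auto simp: I_def)
          show "V (prod.swap i) * (V i * U) = U" if "i \<in> I" "U \<in> space \<mu>" for i U
            using Vinv that by (simp add: sp)
          show "(\<lambda>U. t * f U) \<in> borel_measurable \<mu>" by measurable
          show "\<bar>t * f U\<bar> \<le> (\<Sum>i<n. b i) * G + \<bar>(\<Sum>i<n. b i) * G / real n\<bar>" if "U \<in> space \<mu>" for U
            using bf[OF that] t by (simp add: abs_mult)
          show "(\<Sum>i\<in>I. t * f U - t * f (V i * U)) = 2 * real n * s\<^sup>2 * (t * f U)" if "U \<in> space \<mu>" for U
          proof -
            have U: "U \<in> orthogonal_group n" using that sp by simp
            have "(\<Sum>i\<in>I. t * f U - t * f (V i * U)) = t * (\<Sum>p<n. \<Sum>q<n. f U - f (V (p, q) * U))"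
              unfolding I_def by (simp add: sum.cartesian_product sum_distrib_left right_diff_distrib case_prod_unfold)
            also have "(\<Sum>p<n. \<Sum>q<n. f U - f (V (p, q) * U)) = (\<Sum>p<n. \<Sum>q<n. h (Y U) - h (givens n p q c s * Y U))"
              using YV U by (intro sum.cong refl) (simp add: f_alt)
            also have "\<dots> = 2 * real n * s\<^sup>2 * f U"
              unfolding f_alt h_def G_def by (rule conj_diag_givens_sum_diff[OF Y[OF U] n cs])
            finally show ?thesis by simp
          qed
          show "(\<Sum>i\<in>I. (t * f U - t * f (V i * U))\<^sup>2) \<le> 20 * s\<^sup>2 * S" if "U \<in> space \<mu>" for U
          proof -
            have U: "U \<in> orthogonal_group n" using that sp by simp
            have t2: "t\<^sup>2 = 1" using t by (simp add: abs_square_eq_1)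
            have "(\<Sum>i\<in>I. (t * f U - t * f (V i * U))\<^sup>2) = (\<Sum>p<n. \<Sum>q<n. (f U - f (V (p, q) * U))\<^sup>2)"
              unfolding I_def right_diff_distrib[symmetric] power_mult_distrib t2
              by (simp add: sum.cartesian_product case_prod_unfold)
            also have "\<dots> = (\<Sum>p<n. \<Sum>q<n. (h (Y U) - h (givens n p q c s * Y U))\<^sup>2)"
              using YV U by (intro sum.cong refl) (simp add: f_alt)
            also have "\<dots> \<le> 20 * s\<^sup>2 * S"
              unfolding h_def S_def
              by (rule conj_diag_givens_sum_sq[OF Y[OF U] cs b g small[unfolded K_def G_def S_def]])
            finally show ?thesis .
          qed
        qed (rule x)
        also have "x * (20 * s\<^sup>2 * S) = 2 * real n * s\<^sup>2 * (x * v)"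
          using n by (simp add: v_def)
        finally have "(2 * real n * s\<^sup>2) * expectation (\<lambda>U. t * f U * exp (x * (t * f U)))
            \<le> (2 * real n * s\<^sup>2) * (x * v * expectation (\<lambda>U. exp (x * (t * f U))))"
          by (simp add: mult_ac)
        moreover have "2 * real n * s\<^sup>2 > 0" using n s2(2) by simp
        ultimately show ?thesis by (rule mult_left_le_imp_le)
      qed
      have "prob {U \<in> space \<mu>. t * f U \<ge> \<epsilon> * sqrt S} \<le> exp (- (\<epsilon> * sqrt S)\<^sup>2 / (8 * v))"
        by (rule tail_bound_of_derivative_bound[OF _ _ v der]) (use bf t \<epsilon> S in \<open>auto simp: abs_mult\<close>)
      also have "- (\<epsilon> * sqrt S)\<^sup>2 / (8 * v) = - (1 / 80) * real n * \<epsilon>\<^sup>2"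
        using S n by (simp add: v_def power_mult_distrib)
      finally show ?thesis .
    qed
    have "1 - measure \<mu> {U \<in> space \<mu>. \<bar>f U\<bar> \<le> \<epsilon> * sqrt S} = prob (space \<mu> - {U \<in> space \<mu>. \<bar>f U\<bar> \<le> \<epsilon> * sqrt S})"
      by (subst prob_compl) auto
    also have "\<dots> \<le> prob ({U \<in> space \<mu>. 1 * f U \<ge> \<epsilon> * sqrt S} \<union> {U \<in> space \<mu>. - 1 * f U \<ge> \<epsilon> * sqrt S})"
      by (intro finite_measure_mono) auto
    also have "\<dots> \<le> prob {U \<in> space \<mu>. 1 * f U \<ge> \<epsilon> * sqrt S} + prob {U \<in> space \<mu>. - 1 * f U \<ge> \<epsilon> * sqrt S}"
      by (rule measure_Un_le) measurable
    also have "\<dots> \<le> 2 * exp (- (1 / 80) * real n * \<epsilon>\<^sup>2)"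
      using tail[of 1] tail[of "- 1"] by simp
    finally show ?thesis by simp
  qed
qed

section \<open>Reduction of the traces to eigenvalues\<close>

lemma sum_diag_mult_commute:
  fixes P Q :: "real mat"
  assumes "P \<in> carrier_mat m n" "Q \<in> carrier_mat n m"
  shows "(\<Sum>i<m. (P * Q) $$ (i, i)) = (\<Sum>i<n. (Q * P) $$ (i, i))"
proof -
  have "(\<Sum>i<m. (P * Q) $$ (i, i)) = (\<Sum>i<m. \<Sum>k<n. P $$ (i, k) * Q $$ (k, i))"
    using assms by (intro sum.cong) (auto simp: scalar_prod_def atLeast0LessThan)
  also have "\<dots> = (\<Sum>k<n. \<Sum>i<m. Q $$ (k, i) * P $$ (i, k))"
    by (subst sum.swap) (simp add: mult.commute)
  also have "\<dots> = (\<Sum>i<n. (Q * P) $$ (i, i))"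
    using assms by (intro sum.cong) (auto simp: scalar_prod_def atLeast0LessThan)
  finally show ?thesis .
qed

lemma mat_diag_conj_entry:
  assumes "X \<in> carrier_mat n n" "i < n" "j < n"
  shows "(X * mat_diag n g * transpose_mat X) $$ (i, j) = conj_diag n g X i j"
  using assms by (simp add: mat_diag_mult_right scalar_prod_def atLeast0LessThan conj_diag_def mult_ac)

lemma sum_diag_mat_diag_conj:
  assumes X: "X \<in> orthogonal_group n"
  shows "(\<Sum>i<n. (X * mat_diag n g * transpose_mat X) $$ (i, i)) = (\<Sum>i<n. g i)"
proof -
  have "X \<in> carrier_mat n n" using X by (simp add: orthogonal_group_def)
  hence "(\<Sum>i<n. (X * mat_diag n g * transpose_mat X) $$ (i, i)) = (\<Sum>i<n. conj_diag n g X i i)"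
    by (intro sum.cong refl mat_diag_conj_entry) auto
  thus ?thesis using conj_diag_trace[OF X] by simp
qed

text \<open>Cyclicity of the trace is used twice: first to bring the two outer factors together as
  A^T A, which turns an m by m trace into an n by n one, and then to move \<open>W\<close> around,
  so that U enters only through W^T U Z.\<close>

lemma sum_diag_conj:
  assumes A: "A \<in> carrier_mat m n" and W: "W \<in> orthogonal_group n" and Z: "Z \<in> orthogonal_group n"
    and U: "U \<in> orthogonal_group n"
    and AW: "transpose_mat A * A = W * mat_diag n b * transpose_mat W"
    and CZ: "C = Z * mat_diag n g * transpose_mat Z"
  shows "(\<Sum>i<m. (A * U * C * transpose_mat U * transpose_mat A) $$ (i, i)) =
    (\<Sum>i<n. b i * conj_diag n g (transpose_mat W * U * Z) i i)"
proof -
  define D where "D = mat_diag n b"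
  define E where "E = mat_diag n g"
  have c: "W \<in> carrier_mat n n" "Z \<in> carrier_mat n n" "U \<in> carrier_mat n n"
      "transpose_mat W \<in> carrier_mat n n" "transpose_mat Z \<in> carrier_mat n n" "transpose_mat U \<in> carrier_mat n n"
      "transpose_mat A \<in> carrier_mat n m"
      "D \<in> carrier_mat n n" "E \<in> carrier_mat n n"
    using W Z U A by (auto simp: orthogonal_group_def D_def E_def)
  define X where "X = transpose_mat W * U * Z"
  have X: "X \<in> carrier_mat n n" using c by (simp add: X_def)
  define N where "N = U * C * transpose_mat U"
  have C: "C \<in> carrier_mat n n" unfolding CZ E_def[symmetric] by (intro mult_carrier_mat[of _ n n _ n] c)
  have N: "N \<in> carrier_mat n n" unfolding N_def by (intro mult_carrier_mat[of _ n n _ n] c C)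
  note assoc = assoc_mult_mat[of _ n n _ n _ n]
  have "(D * (X * E * transpose_mat X)) $$ (i, i) = b i * conj_diag n g X i i" if "i < n" for i
  proof -
    have "X * E * transpose_mat X \<in> carrier_mat n n"
      using X c by (intro mult_carrier_mat[of _ n n _ n]) auto
    hence "(D * (X * E * transpose_mat X)) $$ (i, i) = b i * (X * E * transpose_mat X) $$ (i, i)"
      using mat_diag_mult_left[of "X * E * transpose_mat X" n n b] that by (simp add: D_def)
    thus ?thesis using mat_diag_conj_entry[OF X that that, of g] by (simp only: E_def)
  qed
  hence entries: "(\<Sum>i<n. (D * (X * E * transpose_mat X)) $$ (i, i)) = (\<Sum>i<n. b i * conj_diag n g X i i)"
    by (intro sum.cong refl) auto
  have "A * U * C * transpose_mat U * transpose_mat A = A * (N * transpose_mat A)"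
    using A C c by (simp add: N_def assoc_mult_mat[of _ m n _ n _ n] assoc_mult_mat[of _ m n _ n _ m]
      assoc_mult_mat[of _ n n _ n _ m] assoc)
  hence "(\<Sum>i<m. (A * U * C * transpose_mat U * transpose_mat A) $$ (i, i)) = (\<Sum>i<m. (A * (N * transpose_mat A)) $$ (i, i))"
    by simp
  also have "\<dots> = (\<Sum>i<n. ((N * transpose_mat A) * A) $$ (i, i))"
    using A N c by (intro sum_diag_mult_commute) auto
  also have "(N * transpose_mat A) * A = N * (W * D * transpose_mat W)"
    using A N c by (simp add: assoc_mult_mat[of _ n n _ m _ n] AW D_def)
  also have "\<dots> = (N * W) * (D * transpose_mat W)"
    using N c by (simp add: assoc)
  also have "(\<Sum>i<n. ((N * W) * (D * transpose_mat W)) $$ (i, i)) =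
      (\<Sum>i<n. ((D * transpose_mat W) * (N * W)) $$ (i, i))"
    using N c by (intro sum_diag_mult_commute) auto
  also have "(D * transpose_mat W) * (N * W) = D * (X * E * transpose_mat X)"
    using c by (simp add: X_def N_def CZ E_def[symmetric] transpose_mult[of _ n n _ n] assoc)
  finally show ?thesis using entries by (simp add: X_def)
qed

text \<open>Each diagonal value is the quadratic form of \<open>M\<close> at the corresponding
  column of \<open>W\<close>; this transfers positive semidefiniteness to the eigenvalues.\<close>

lemma diag_entry_eq_quadratic_form:
  assumes W: "W \<in> orthogonal_group n" and M: "M = W * mat_diag n b * transpose_mat W" and i: "i < n"
  shows "b i = col W i \<bullet> (M *\<^sub>v col W i)"
proof -
  define D where "D = mat_diag n b"
  have c: "W \<in> carrier_mat n n" "transpose_mat W \<in> carrier_mat n n" "D \<in> carrier_mat n n"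
    using W by (auto simp: orthogonal_group_def D_def)
  have Mc: "M \<in> carrier_mat n n" unfolding M D_def[symmetric] by (intro mult_carrier_mat[of _ n n _ n] c)
  have "transpose_mat W * (M * W) = (transpose_mat W * W) * D * (transpose_mat W * W)"
    using c by (simp add: M D_def[symmetric] assoc_mult_mat[of _ n n _ n _ n])
  also have "\<dots> = D"
    using W c by (simp add: orthogonal_group_def)
  finally have "b i = (transpose_mat W * (M * W)) $$ (i, i)"
    using i by (simp add: D_def mat_diag_def)
  also have "\<dots> = col W i \<bullet> (M *\<^sub>v col W i)"
    using c Mc i col_mult2[OF Mc c(1) i] by simp
  finally show ?thesis .
qed

text \<open>The shift by \<open>Suc\<close> passes from eigenvalues numbered from 1 to matrix
  indices from 0.\<close>

lemma eigenvalues_desc_diagonalization: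
  assumes ev: "eigenvalues_desc n M \<beta>" and M: "M \<in> carrier_mat n n" "transpose_mat M = M"
    and psd: "\<And>v. v \<in> carrier_vec n \<Longrightarrow> 0 \<le> v \<bullet> (M *\<^sub>v v)"
  obtains W where "W \<in> orthogonal_group n" "M = W * mat_diag n (\<lambda>i. \<beta> (Suc i)) * transpose_mat W"
    "\<And>i. i < n \<Longrightarrow> 0 \<le> \<beta> (Suc i)" "\<And>i j. i \<le> j \<Longrightarrow> j < n \<Longrightarrow> \<beta> (Suc j) \<le> \<beta> (Suc i)"
proof -
  obtain W where W: "W \<in> orthogonal_group n" "M = W * mat_diag n (\<lambda>i. map \<beta> [1..<Suc n] ! i) * transpose_mat W"
    using real_symmetric_diagonalization[OF M eigenvalues_desc_char_poly[OF ev M(1)]] by auto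
  have "mat_diag n (\<lambda>i. map \<beta> [1..<Suc n] ! i) = mat_diag n (\<lambda>i. \<beta> (Suc i))"
    by (rule eq_matI) (auto simp: mat_diag_def simp del: upt_Suc)
  hence MW: "M = W * mat_diag n (\<lambda>i. \<beta> (Suc i)) * transpose_mat W" using W(2) by simp
  have Wc: "W \<in> carrier_mat n n" using W by (simp add: orthogonal_group_def)
  have nn: "0 \<le> \<beta> (Suc i)" if "i < n" for i
    using diag_entry_eq_quadratic_form[OF W(1) MW that] psd[of "col W i"] Wc that by simp
  have "\<beta> (Suc j) \<le> \<beta> (Suc i)" if "i \<le> j" "j < n" for i j
    using ev that by (auto simp: eigenvalues_desc_def monotone_on_def)
  with that[OF W(1) MW nn] show thesis by blast
qed

text \<open>All three traces become sums over eigenvalues, and the deviation is the centred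
  quadratic form divided by m. The factor 1 / m therefore cancels on both sides of the
  event.\<close>

lemma haar_conjugation_concentration:
  fixes \<epsilon> :: real
  assumes m: "1 \<le> m" and n: "1 \<le> n" and C: "sym_pos_def n C" and A: "A \<in> carrier_mat m n"
    and \<beta>: "eigenvalues_desc n (transpose_mat A * A) \<beta>" and \<gamma>: "eigenvalues_desc n C \<gamma>"
    and \<mu>: "haar_prob_orthogonal n \<mu>" and \<epsilon>: "\<epsilon> \<ge> 0"
  shows "1 - 2 * exp (- (1 / 80) * real n * \<epsilon>\<^sup>2) \<le>
    measure \<mu> {U \<in> space \<mu>.
      \<bar>ntrace m (A * U * C * transpose_mat U * transpose_mat A) - ntrace n C * ntrace m (A * transpose_mat A)\<bar>
        \<le> \<epsilon> / real m * sqrt (\<Sum>i=1..n. (\<beta> i)\<^sup>2 * (\<gamma> i)\<^sup>2)}"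
proof -
  define b where "b = (\<lambda>i. \<beta> (Suc i))"
  define g where "g = (\<lambda>i. \<gamma> (Suc i))"
  have Cc: "C \<in> carrier_mat n n" "transpose_mat C = C" using C by (auto simp: sym_pos_def_def)
  have Cpsd: "0 \<le> v \<bullet> (C *\<^sub>v v)" if "v \<in> carrier_vec n" for v
    \<comment> \<open>Positive definiteness concerns nonzero vectors only; at the zero vector the
      form is 0.\<close>
    using C that Cc by (cases "v = 0\<^sub>v n") (auto simp: sym_pos_def_def less_imp_le)
  obtain Z where Z: "Z \<in> orthogonal_group n" "C = Z * mat_diag n g * transpose_mat Z"
    "\<And>i. i < n \<Longrightarrow> 0 \<le> g i" "\<And>i j. i \<le> j \<Longrightarrow> j < n \<Longrightarrow> g j \<le> g i"
    using eigenvalues_desc_diagonalization[OF \<gamma> Cc Cpsd] unfolding g_def by blast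
  have At: "transpose_mat A \<in> carrier_mat n m" using A by simp
  have AAc: "transpose_mat A * A \<in> carrier_mat n n" "transpose_mat (transpose_mat A * A) = transpose_mat A * A"
    using A At by (auto simp: transpose_mult[OF At A])
  have AApsd: "0 \<le> v \<bullet> ((transpose_mat A * A) *\<^sub>v v)" if v: "v \<in> carrier_vec n" for v
  proof -
    have "v \<bullet> ((transpose_mat A * A) *\<^sub>v v) = (A *\<^sub>v v) \<bullet> (A *\<^sub>v v)"
      using transpose_vec_mult_scalar[OF A v, of "A *\<^sub>v v"] A At v
      by (simp add: assoc_mult_mat_vec[OF At A v] comm_scalar_prod[of v n])
    also have "\<dots> \<ge> 0" by (auto simp: scalar_prod_def intro!: sum_nonneg)
    finally show ?thesis .
  qed
  obtain W where W: "W \<in> orthogonal_group n" "transpose_mat A * A = W * mat_diag n b * transpose_mat W"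
    "\<And>i. i < n \<Longrightarrow> 0 \<le> b i" "\<And>i j. i \<le> j \<Longrightarrow> j < n \<Longrightarrow> b j \<le> b i"
    using eigenvalues_desc_diagonalization[OF \<beta> AAc AApsd] unfolding b_def by blast
  define f where "f = (\<lambda>U. (\<Sum>i<n. b i * conj_diag n g (transpose_mat W * U * Z) i i) - (\<Sum>i<n. b i) * (\<Sum>i<n. g i) / real n)"
  have S: "(\<Sum>i=1..n. (\<beta> i)\<^sup>2 * (\<gamma> i)\<^sup>2) = (\<Sum>i<n. (b i)\<^sup>2 * (g i)\<^sup>2)"
    by (simp add: b_def g_def sum.atLeast1_atMost_eq)
  have "ntrace m (A * transpose_mat A) = (\<Sum>i<n. b i) / real m"
    using sum_diag_mult_commute[OF A At] sum_diag_mat_diag_conj[OF W(1), of b] by (simp add: ntrace_def W(2))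
  moreover have "ntrace n C = (\<Sum>i<n. g i) / real n"
    using sum_diag_mat_diag_conj[OF Z(1), of g] by (simp add: ntrace_def Z(2))
  moreover have "ntrace m (A * U * C * transpose_mat U * transpose_mat A) =
      (\<Sum>i<n. b i * conj_diag n g (transpose_mat W * U * Z) i i) / real m" if "U \<in> space \<mu>" for U
    using sum_diag_conj[OF A W(1) Z(1) _ W(2) Z(2), of U] that \<mu>
    by (simp add: ntrace_def haar_prob_orthogonal_def)
  ultimately have "ntrace m (A * U * C * transpose_mat U * transpose_mat A) - ntrace n C * ntrace m (A * transpose_mat A) =
      f U / real m" if "U \<in> space \<mu>" for U
    using that by (simp add: f_def diff_divide_distrib mult.commute)
  hence "{U \<in> space \<mu>. \<bar>ntrace m (A * U * C * transpose_mat U * transpose_mat A) - ntrace n C * ntrace m (A * transpose_mat A)\<bar>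
        \<le> \<epsilon> / real m * sqrt (\<Sum>i=1..n. (\<beta> i)\<^sup>2 * (\<gamma> i)\<^sup>2)} =
      {U \<in> space \<mu>. \<bar>f U\<bar> \<le> \<epsilon> * sqrt (\<Sum>i<n. (b i)\<^sup>2 * (g i)\<^sup>2)}"
    unfolding S using m by (intro Collect_cong conj_cong refl) (simp add: abs_divide divide_le_cancel)
  thus ?thesis
    using haar_quadratic_form_tail_bound[OF \<mu> _ W(1) Z(1) W(3,4) Z(3,4) \<epsilon>] n by (simp add: f_def)
qed

theorem theorem2p3:
  shows "\<exists>\<kappa>\<^sub>2 :: real. \<kappa>\<^sub>2 > 0 \<and>
    (\<forall>(m :: nat) (n :: nat) (C :: real mat) (A :: real mat) (\<beta> :: nat \<Rightarrow> real) (\<gamma> :: nat \<Rightarrow> real)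
        (\<mu> :: real mat measure).
      m \<ge> 1 \<and> n \<ge> 1 \<and>
      sym_pos_def n C \<and>
      A \<in> carrier_mat m n \<and>
      eigenvalues_desc n (transpose_mat A * A) \<beta> \<and>
      eigenvalues_desc n C \<gamma> \<and>
      haar_prob_orthogonal n \<mu> \<longrightarrow>
      (\<forall>\<epsilon> :: real. \<epsilon> \<ge> 0 \<longrightarrow>
        measure \<mu> {U \<in> space \<mu>.
            \<bar>ntrace m (A * U * C * transpose_mat U * transpose_mat A)
              - ntrace n C * ntrace m (A * transpose_mat A)\<bar>
            \<le> \<epsilon> / real m * sqrt (\<Sum>i=1..n. (\<beta> i)\<^sup>2 * (\<gamma> i)\<^sup>2)}
          \<ge> 1 - 2 * exp (- \<kappa>\<^sub>2 * real n * \<epsilon>\<^sup>2)) \<and>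
      (\<forall>\<delta> :: real. 0 < \<delta> \<and> \<delta> < 1 \<longrightarrow>
        measure \<mu> {U \<in> space \<mu>.
            \<bar>ntrace m (A * U * C * transpose_mat U * transpose_mat A)
              - ntrace n C * ntrace m (A * transpose_mat A)\<bar>
            \<le> sqrt (2 * ln (2 / \<delta>) / (\<kappa>\<^sub>2 * real n)) * (1 / real m)
                * sqrt (\<Sum>i=1..n. (\<beta> i)\<^sup>2 * (\<gamma> i)\<^sup>2)}
          \<ge> 1 - \<delta>))"
\<comment> \<open>The constant comes from the tail exponent a^2 / (8 v) with a^2 = \<epsilon>^2 S
  and v = 10 S / n.\<close>
proof (intro exI[of _ "1 / 80"] conjI allI impI, goal_cases)
  case (2 m n C A \<beta> \<gamma> \<mu> \<epsilon>)
  thus ?case by (intro haar_conjugation_concentration) auto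
next
  case (3 m n C A \<beta> \<gamma> \<mu> \<delta>)
  define \<epsilon> where "\<epsilon> = sqrt (2 * ln (2 / \<delta>) / (1 / 80 * real n))"
  have \<delta>: "0 < \<delta>" "\<delta> < 1" and n: "n \<ge> 1" using 3 by auto
  have ln0: "ln (2 / \<delta>) > 0" using \<delta> by simp
  hence "\<epsilon>\<^sup>2 = 2 * ln (2 / \<delta>) / (1 / 80 * real n)" and \<epsilon>: "\<epsilon> \<ge> 0"
    by (simp_all add: \<epsilon>_def)
  hence "- (1 / 80) * real n * \<epsilon>\<^sup>2 = - (2 * ln (2 / \<delta>))"
    using n by simp
  hence "2 * exp (- (1 / 80) * real n * \<epsilon>\<^sup>2) = 2 * exp (- (2 * ln (2 / \<delta>)))" by simp
  \<comment> \<open>The chosen \<epsilon> makes the failure bound 2 (\<delta> / 2)^2; dropping the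
    factor 2 in the exponent weakens it to \<delta>, as ln (2 / \<delta>) is positive.\<close>
  also have "\<dots> \<le> 2 * exp (- ln (2 / \<delta>))" using ln0 by simp
  also have "\<dots> = \<delta>" using \<delta> by (simp add: exp_minus)
  finally have "1 - \<delta> \<le> 1 - 2 * exp (- (1 / 80) * real n * \<epsilon>\<^sup>2)" by simp
  also have "\<dots> \<le> measure \<mu> {U \<in> space \<mu>.
      \<bar>ntrace m (A * U * C * transpose_mat U * transpose_mat A) - ntrace n C * ntrace m (A * transpose_mat A)\<bar>
        \<le> \<epsilon> / real m * sqrt (\<Sum>i=1..n. (\<beta> i)\<^sup>2 * (\<gamma> i)\<^sup>2)}"
    using 3 \<epsilon> by (intro haar_conjugation_concentration) auto
  finally show ?case by (simp add: \<epsilon>_def)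
qed simp

end
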